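(* For every $T\in\mathscr C$ the following are equivalent: (i) $T(H_A)\neq H_A$; (ii) some $Z\in\mathfrak k_A$ satisfies $\operatorname{Lie}\{Z,TZT\}=\mathfrak g_2$; (iii) at least one of the six derivations $U_{ij}$ ($i\in\{1,2\}$, $j\in\{1,2,3\}$) satisfies $\operatorname{Lie}\{U_{ij},TU_{ij}T\}=\mathfrak g_2$. If these conditions hold, the set $\{Z\in\mathfrak k_A:\operatorname{Lie}\{Z,TZT\}=\mathfrak g_2\}$ is a nonempty real Zariski-open subset of $\mathfrak k_A$ and has full Lebesgue measure (its complement has measure zero). For any other quaternionic context $H=g(H_A)$ with $g\in G_2$, the same assertions hold with $H_A,\mathfrak k_A,U_{ij}$ replaced by $H$, $\mathfrak k_H$, $gU_{ij}g^{-1}$.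
   Context: Octonions: $\mathbb O$ has real basis $1,e_1,\dots,e_7$ with $1$ the identity, $e_i^2=-1$, and multiplication given by the oriented triples $(123),(145),(176),(246),(257),(347),(365)$: for a triple $(abc)$, $e_ae_b=e_c$, $e_be_c=e_a$, $e_ce_a=e_b$, and reversing the order changes the sign. The inner product makes $1,e_1,\dots,e_7$ orthonormal; $V=\operatorname{Im}\mathbb O$. $G_2=\operatorname{Aut}(\mathbb O)$ and $\mathfrak g_2=\operatorname{Der}(\mathbb O)$ are identified with their faithful actions on $V$; $TZT$ is composition of linear maps. $\operatorname{Lie}\{U,W\}$ is the smallest real Lie subalgebra containing $U,W$. A quaternionic context is a unital subalgebra $H\subset\mathbb O$ isomorphic to the quaternions; $\mathfrak k_H=\{Z\in\mathfrak g_2:Z(H)\subseteq H\}$. The quaternionic reflection $\sigma_H\in G_2$ is $+1$ on $H$ and $-1$ on $H^\perp$; $\mathscr C$ is the set of all $\sigma_H$. $H_A=\operatorname{span}\{1,e_1,e_2,e_3\}$, $\mathfrak k_A=\mathfrak k_{H_A}$ (dimension $6$). For $q_a,q_b\in\operatorname{span}\{e_1,e_2,e_3\}$, $Z(q_a,q_b)\in\mathfrak k_A$ is the derivation $Z(q_a,q_b)(x+ye_4)=[q_a,x]+(q_by-yq_a)e_4$ ($x,y\in H_A$). Let $\mathbf a^{(1)}=e_1$, $\mathbf a^{(2)}=e_2$, $\mathbf b^{(1)}=e_1+e_2$, $\mathbf b^{(2)}=e_1+e_3$, $\mathbf b^{(3)}=e_2+e_3$ and $U_{ij}=6Z(\mathbf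 a^{(i)},\mathbf b^{(j)})$. *)

theory Defs
  imports "HOL-Analysis.Analysis"
begin

(* The octonions are real^8, with coordinates indexed by 0, ..., 7 :: 8 (note 8 = 0 in this type);
   the inner product of real^8 makes the basis e 0 = 1, e 1, ..., e 7 orthonormal. *)

definition e :: "8 \<Rightarrow> real^8"
  where "e i = axis i 1"

definition triples :: "(8 \<times> 8 \<times> 8) set"
  where "triples = {(1,2,3), (1,4,5), (1,7,6), (2,4,6), (2,5,7), (3,4,7), (3,6,5)}"

definition cyclic_triples :: "(8 \<times> 8 \<times> 8) set"
  where "cyclic_triples = (\<Union>(a,b,c)\<in>triples. {(a,b,c), (b,c,a), (c,a,b)})"

definition basis_mult :: "8 \<Rightarrow> 8 \<Rightarrow> real^8"
  where "basis_mult i j =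
    (if i = 0 then e j
     else if j = 0 then e i
     else if i = j then - e 0
     else (\<Sum>k\<in>UNIV. (of_bool ((i,j,k) \<in> cyclic_triples) - of_bool ((j,i,k) \<in> cyclic_triples)) *\<^sub>R e k))"

definition oct_mult :: "real^8 \<Rightarrow> real^8 \<Rightarrow> real^8"  (infixl "\<star>" 70)
  where "x \<star> y = (\<Sum>i\<in>UNIV. \<Sum>j\<in>UNIV. (x $ i * y $ j) *\<^sub>R basis_mult i j)"

(* Linear endomorphisms of the octonions are matrices with respect to e 0, ..., e 7.  Automorphisms
   fix e 0 and derivations kill it, and both preserve the imaginary octonions, so working on the
   octonions or on the imaginary octonions gives the same group, Lie algebra and compositions. *)

type_synonym endo = "real^8^8"

definition G2 :: "endo set"
  where "G2 = {g. invertible g \<and> (\<forall>x y. g *v (x \<star> y) = (g *v x) \<star> (g *v y))}"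

definition g2 :: "endo set"
  where "g2 = {D. \<forall>x y. D *v (x \<star> y) = (D *v x) \<star> y + x \<star> (D *v y)}"

definition lie_bracket :: "endo \<Rightarrow> endo \<Rightarrow> endo"
  where "lie_bracket X Y = X ** Y - Y ** X"

definition lie_subalgebra :: "endo set \<Rightarrow> bool"
  where "lie_subalgebra L \<longleftrightarrow> subspace L \<and> (\<forall>X\<in>L. \<forall>Y\<in>L. lie_bracket X Y \<in> L)"

definition Lie :: "endo set \<Rightarrow> endo set"
  where "Lie S = lie_subalgebra hull S"

(* Hamilton's quaternions, in the scalar-vector form. *)
definition quat_mult :: "real \<times> (real^3) \<Rightarrow> real \<times> (real^3) \<Rightarrow> real \<times> (real^3)"
  where "quat_mult p q =
    (fst p * fst q - snd p \<bullet> snd q,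
     fst p *\<^sub>R snd q + fst q *\<^sub>R snd p + cross3 (snd p) (snd q))"

definition quaternionic_context :: "(real^8) set \<Rightarrow> bool"
  where "quaternionic_context H \<longleftrightarrow>
    subspace H \<and> e 0 \<in> H \<and> (\<forall>x\<in>H. \<forall>y\<in>H. x \<star> y \<in> H) \<and>
    (\<exists>\<phi> :: real \<times> (real^3) \<Rightarrow> real^8. linear \<phi> \<and> bij_betw \<phi> UNIV H \<and>
       (\<forall>p q. \<phi> (quat_mult p q) = \<phi> p \<star> \<phi> q))"

definition \<kk> :: "(real^8) set \<Rightarrow> endo set"
  where "\<kk> H = {Z \<in> g2. \<forall>x\<in>H. Z *v x \<in> H}"

(* For a subspace H there is exactly one such T. *)
definition quaternionic_reflection :: "(real^8) set \<Rightarrow> endo \<Rightarrow> bool"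
  where "quaternionic_reflection H T \<longleftrightarrow> (\<forall>x\<in>H. T *v x = x) \<and> (\<forall>x\<in>H\<^sup>\<bottom>. T *v x = - x)"

definition \<C> :: "endo set"
  where "\<C> = {T. \<exists>H. quaternionic_context H \<and> quaternionic_reflection H T}"

definition H_A :: "(real^8) set"
  where "H_A = span {e 0, e 1, e 2, e 3}"

(* The unique x, y in H_A with v = x + y * e 4; note e 1 * e 4 = e 5, e 2 * e 4 = e 6,
   e 3 * e 4 = e 7.  The defining equation of Z(q_a, q_b) is Z_der_apply below. *)

definition part1 :: "real^8 \<Rightarrow> real^8"
  where "part1 v = v $ 0 *\<^sub>R e 0 + v $ 1 *\<^sub>R e 1 + v $ 2 *\<^sub>R e 2 + v $ 3 *\<^sub>R e 3"

definition part2 :: "real^8 \<Rightarrow> real^8"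
  where "part2 v = v $ 4 *\<^sub>R e 0 + v $ 5 *\<^sub>R e 1 + v $ 6 *\<^sub>R e 2 + v $ 7 *\<^sub>R e 3"

definition Z_der :: "real^8 \<Rightarrow> real^8 \<Rightarrow> endo"
  where "Z_der q\<^sub>a q\<^sub>b = matrix (\<lambda>v.
    (q\<^sub>a \<star> part1 v - part1 v \<star> q\<^sub>a) + (q\<^sub>b \<star> part2 v - part2 v \<star> q\<^sub>a) \<star> e 4)"

definition a_vec :: "nat \<Rightarrow> real^8"
  where "a_vec i = (if i = 1 then e 1 else e 2)"

definition b_vec :: "nat \<Rightarrow> real^8"
  where "b_vec j = (if j = 1 then e 1 + e 2 else if j = 2 then e 1 + e 3 else e 2 + e 3)"

definition U :: "nat \<Rightarrow> nat \<Rightarrow> endo"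
  where "U i j = 6 *\<^sub>R Z_der (a_vec i) (b_vec j)"

(* Polynomial functions on a subspace W are the restrictions of those on the ambient space. *)
definition zariski_open_in :: "endo set \<Rightarrow> endo set \<Rightarrow> bool"
  where "zariski_open_in W S \<longleftrightarrow> S \<subseteq> W \<and>
    (\<exists>P. (\<forall>p\<in>P. real_polynomial_function p) \<and> W - S = {Z\<in>W. \<forall>p\<in>P. p Z = 0})"

(* N has Lebesgue measure zero in the 6-dimensional space W, measured in linear coordinates;
   the choice of coordinates does not matter. *)
definition null_in :: "endo set \<Rightarrow> endo set \<Rightarrow> bool"
  where "null_in W N \<longleftrightarrow> N \<subseteq> W \<and>
    (\<exists>\<phi> :: real^6 \<Rightarrow> endo. linear \<phi> \<and> bij_betw \<phi> UNIV W \<and> negligible {x. \<phi> x \<in> N})"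


lemma UNIV_8: "(UNIV::8 set) = {0,1,2,3,4,5,6,7}"
proof -
  have "card {0,1,2,3,4,5,6,7::8} = CARD(8)" by simp
  then show ?thesis by (metis card_subset_eq finite subset_UNIV)
qed

lemma sum_8: "(\<Sum>i\<in>(UNIV::8 set). f i) = f 0 + f 1 + f 2 + f 3 + f 4 + f 5 + f 6 + f 7"
  unfolding UNIV_8 by (simp add: add.assoc)

lemma forall_8: "(\<forall>i::8. P i) \<longleftrightarrow> P 0 \<and> P 1 \<and> P 2 \<and> P 3 \<and> P 4 \<and> P 5 \<and> P 6 \<and> P 7"
  using UNIV_8 by (metis UNIV_I empty_iff insert_iff)

lemma oct_mult_e: "x \<star> e j = (\<Sum>i\<in>UNIV. x $ i *\<^sub>R basis_mult i j)"
  by (simp add: oct_mult_def e_def axis_def if_distrib if_distribR cong: if_cong)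

lemma oct_mult_e4:
  "x \<star> e 4 = x $ 0 *\<^sub>R e 4 + x $ 1 *\<^sub>R e 5 + x $ 2 *\<^sub>R e 6 + x $ 3 *\<^sub>R e 7
     - x $ 4 *\<^sub>R e 0 - x $ 5 *\<^sub>R e 1 - x $ 6 *\<^sub>R e 2 - x $ 7 *\<^sub>R e 3"
  by (simp add: oct_mult_e basis_mult_def cyclic_triples_def triples_def sum_8)

lemma H_A_iff: "x \<in> H_A \<longleftrightarrow> x$4=0 \<and> x$5=0 \<and> x$6=0 \<and> x$7=0"
proof
  show "x \<in> H_A \<Longrightarrow> x$4=0 \<and> x$5=0 \<and> x$6=0 \<and> x$7=0"
    unfolding H_A_def by (induction rule: span_induct_alt) (auto simp: e_def axis_def)
  assume a: "x$4=0 \<and> x$5=0 \<and> x$6=0 \<and> x$7=0"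
  have "x = part1 x" using a by (simp add: vec_eq_iff forall_8 part1_def e_def axis_def)
  also have "\<dots> \<in> H_A" unfolding part1_def H_A_def by (intro span_add span_scale span_base) auto
  finally show "x \<in> H_A" .
qed

lemma part1_part2:
  assumes "x \<in> H_A" "y \<in> H_A"
  shows "part1 (x + y \<star> e 4) = x" "part2 (x + y \<star> e 4) = y"
  using assms unfolding oct_mult_e4
  by (simp_all add: H_A_iff part1_def part2_def vec_eq_iff forall_8 e_def axis_def)

lemma bilinear_oct_mult: "bilinear (\<star>)"
  unfolding bilinear_def
  by (auto intro!: linearI simp: oct_mult_def algebra_simps sum.distrib scaleR_sum_right)

lemma linear_part1: "linear part1" and linear_part2: "linear part2"
  by (auto intro!: linearI simp: part1_def part2_def algebra_simps)

lemma Z_der_apply: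
  assumes "x \<in> H_A" "y \<in> H_A"
  shows "Z_der a b *v (x + y \<star> e 4) = (a \<star> x - x \<star> a) + (b \<star> y - y \<star> a) \<star> e 4"
proof -
  note left = linear_compose[OF _ bilinear_oct_mult[unfolded bilinear_def, THEN conjunct2, rule_format], unfolded o_def]
  note right = linear_compose[OF _ bilinear_oct_mult[unfolded bilinear_def, THEN conjunct1, rule_format], unfolded o_def]
  have "linear (\<lambda>v. (a \<star> part1 v - part1 v \<star> a) + (b \<star> part2 v - part2 v \<star> a) \<star> e 4)"
    by (intro linear_compose_add linear_compose_sub left right linear_part1 linear_part2)
  then show ?thesis
    unfolding Z_der_def by (simp add: matrix_works part1_part2[OF assms])
qed

end

theory Submission
  imports Defs
begin

text \<open>
  Only \<open>T \<in> G2\<close> and \<open>T ** T = mat 1\<close> matter.  With \<open>|a| = 1\<close> and \<open>|b| = sqrt 2\<close> the derivation \<open>Z = Z_der a b\<close>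
  lies in a unique maximal torus and the squares of its frequencies on the root planes are nonzero and distinct, so a
  subalgebra \<open>L\<close> containing \<open>Z\<close> is a sum of root planes and a part of the torus.  Closure under brackets leaves
  only these possibilities for a proper \<open>L\<close>: it kills \<open>a\<close>, or it preserves one of the three \<open>Z\<close>-invariant quaternion
  algebras, which are \<open>H_A\<close> and the spans of \<open>1, a\<close> and \<open>{y \<star> e 4 | b \<star> y = \<plusminus> sqrt 2 (y \<star> a)}\<close>.  For the subalgebra
  generated by \<open>Z\<close> and \<open>T Z T\<close> this means that \<open>T\<close> maps \<open>a\<close> to \<open>\<plusminus> a\<close> or preserves one of the three algebras.  If \<open>T\<close> moves
  \<open>H_A\<close>, it moves the line of \<open>e 1\<close> or that of \<open>e 2\<close>; for such an \<open>a\<close>, failure for two different \<open>b\<close> would give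
  two \<open>T\<close>-invariant algebras meeting in the span of \<open>1, a\<close>, which would then be \<open>T\<close>-invariant.

  Generation means that suitable iterated brackets span \<open>g2\<close>, which is the nonvanishing of a determinant.
\<close>

section \<open>Octonion coordinates and identities\<close>

definition vec8 :: "'a \<Rightarrow> 'a \<Rightarrow> 'a \<Rightarrow> 'a \<Rightarrow> 'a \<Rightarrow> 'a \<Rightarrow> 'a \<Rightarrow> 'a \<Rightarrow> 'a^8"
  where "vec8 a0 a1 a2 a3 a4 a5 a6 a7 = (\<chi> i. if i = 0 then a0 else if i = 1 then a1 else if i = 2 then a2
    else if i = 3 then a3 else if i = 4 then a4 else if i = 5 then a5 else if i = 6 then a6 else a7)"

lemma vec8_nth [simp]:
  "vec8 a0 a1 a2 a3 a4 a5 a6 a7 $ 0 = a0" "vec8 a0 a1 a2 a3 a4 a5 a6 a7 $ 1 = a1"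
  "vec8 a0 a1 a2 a3 a4 a5 a6 a7 $ 2 = a2" "vec8 a0 a1 a2 a3 a4 a5 a6 a7 $ 3 = a3"
  "vec8 a0 a1 a2 a3 a4 a5 a6 a7 $ 4 = a4" "vec8 a0 a1 a2 a3 a4 a5 a6 a7 $ 5 = a5"
  "vec8 a0 a1 a2 a3 a4 a5 a6 a7 $ 6 = a6" "vec8 a0 a1 a2 a3 a4 a5 a6 a7 $ 7 = a7"
  by (simp_all add: vec8_def)

lemma vec_eq_8: "x = y \<longleftrightarrow> x$0 = y$0 \<and> x$1 = y$1 \<and> x$2 = y$2 \<and> x$3 = y$3 \<and> x$4 = y$4 \<and> x$5 = y$5
    \<and> x$6 = y$6 \<and> x$7 = y$7" for x y :: "'a^8"
  by (simp add: vec_eq_iff forall_8)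

lemma e_nth: "e i $ j = (if i = j then 1 else 0)"
  by (simp add: e_def axis_def)

text \<open>Expanding the product once into eight bilinear forms turns the later octonion identities
  into polynomial arithmetic in the coordinates.\<close>

lemma oct_mult_coords:
  "x \<star> y = vec8
    (x$0*y$0 - x$1*y$1 - x$2*y$2 - x$3*y$3 - x$4*y$4 - x$5*y$5 - x$6*y$6 - x$7*y$7)
    (x$0*y$1 + x$1*y$0 + x$2*y$3 - x$3*y$2 + x$4*y$5 - x$5*y$4 - x$6*y$7 + x$7*y$6)
    (x$0*y$2 - x$1*y$3 + x$2*y$0 + x$3*y$1 + x$4*y$6 + x$5*y$7 - x$6*y$4 - x$7*y$5)
    (x$0*y$3 + x$1*y$2 - x$2*y$1 + x$3*y$0 + x$4*y$7 - x$5*y$6 + x$6*y$5 - x$7*y$4)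
    (x$0*y$4 - x$1*y$5 - x$2*y$6 - x$3*y$7 + x$4*y$0 + x$5*y$1 + x$6*y$2 + x$7*y$3)
    (x$0*y$5 + x$1*y$4 - x$2*y$7 + x$3*y$6 - x$4*y$1 + x$5*y$0 - x$6*y$3 + x$7*y$2)
    (x$0*y$6 + x$1*y$7 + x$2*y$4 - x$3*y$5 - x$4*y$2 + x$5*y$3 + x$6*y$0 - x$7*y$1)
    (x$0*y$7 - x$1*y$6 + x$2*y$5 + x$3*y$4 - x$4*y$3 - x$5*y$2 + x$6*y$1 + x$7*y$0)"
  by (simp add: oct_mult_def sum_8 basis_mult_def cyclic_triples_def triples_def vec_eq_8 e_nth)

lemma matrix_vector_8:
  "(A :: real^8^8) *v x = vec8
     (A$0$0*x$0 + A$0$1*x$1 + A$0$2*x$2 + A$0$3*x$3 + A$0$4*x$4 + A$0$5*x$5 + A$0$6*x$6 + A$0$7*x$7)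
     (A$1$0*x$0 + A$1$1*x$1 + A$1$2*x$2 + A$1$3*x$3 + A$1$4*x$4 + A$1$5*x$5 + A$1$6*x$6 + A$1$7*x$7)
     (A$2$0*x$0 + A$2$1*x$1 + A$2$2*x$2 + A$2$3*x$3 + A$2$4*x$4 + A$2$5*x$5 + A$2$6*x$6 + A$2$7*x$7)
     (A$3$0*x$0 + A$3$1*x$1 + A$3$2*x$2 + A$3$3*x$3 + A$3$4*x$4 + A$3$5*x$5 + A$3$6*x$6 + A$3$7*x$7)
     (A$4$0*x$0 + A$4$1*x$1 + A$4$2*x$2 + A$4$3*x$3 + A$4$4*x$4 + A$4$5*x$5 + A$4$6*x$6 + A$4$7*x$7)
     (A$5$0*x$0 + A$5$1*x$1 + A$5$2*x$2 + A$5$3*x$3 + A$5$4*x$4 + A$5$5*x$5 + A$5$6*x$6 + A$5$7*x$7)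
     (A$6$0*x$0 + A$6$1*x$1 + A$6$2*x$2 + A$6$3*x$3 + A$6$4*x$4 + A$6$5*x$5 + A$6$6*x$6 + A$6$7*x$7)
     (A$7$0*x$0 + A$7$1*x$1 + A$7$2*x$2 + A$7$3*x$3 + A$7$4*x$4 + A$7$5*x$5 + A$7$6*x$6 + A$7$7*x$7)"
  by (simp add: matrix_vector_mult_def sum_8 vec_eq_8)

lemma oct_mult_add_left: "(x + y) \<star> z = x \<star> z + y \<star> z"
  and oct_mult_add_right: "z \<star> (x + y) = z \<star> x + z \<star> y"
  and oct_mult_scaleR_left: "(c *\<^sub>R x) \<star> z = c *\<^sub>R (x \<star> z)"
  and oct_mult_scaleR_right: "z \<star> (c *\<^sub>R x) = c *\<^sub>R (z \<star> x)"
  by (simp_all add: oct_mult_coords vec_eq_8 algebra_simps)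

lemma oct_mult_minus_left: "(- x) \<star> z = - (x \<star> z)"
  and oct_mult_minus_right: "z \<star> (- x) = - (z \<star> x)"
  and oct_mult_zero_left: "0 \<star> z = 0"
  and oct_mult_zero_right: "z \<star> 0 = 0"
  by (simp_all add: oct_mult_coords vec_eq_8)

lemma oct_mult_diff_left: "(x - y) \<star> z = x \<star> z - y \<star> z"
  and oct_mult_diff_right: "z \<star> (x - y) = z \<star> x - z \<star> y"
  by (simp_all add: oct_mult_coords vec_eq_8 algebra_simps)

lemmas oct_mult_linear = oct_mult_add_left oct_mult_add_right oct_mult_scaleR_left oct_mult_scaleR_right
  oct_mult_minus_left oct_mult_minus_right oct_mult_diff_left oct_mult_diff_right
  oct_mult_zero_left oct_mult_zero_right

lemma e0_mult [simp]: "e 0 \<star> x = x" "x \<star> e 0 = x"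
  by (simp_all add: oct_mult_coords vec_eq_8 e_nth)

lemma e_mult_table:
  "e 1 \<star> e 1 = - e 0" "e 2 \<star> e 2 = - e 0" "e 4 \<star> e 4 = - e 0"
  "e 1 \<star> e 2 = e 3" "e 1 \<star> e 4 = e 5" "e 2 \<star> e 4 = e 6" "e 3 \<star> e 4 = e 7"
  "e 2 \<star> e 1 = - e 3" "e 4 \<star> e 1 = - e 5" "e 4 \<star> e 2 = - e 6" "e 4 \<star> e 3 = - e 7"
  "e 4 \<star> e 5 = e 1" "e 6 \<star> e 7 = - e 1" "e 2 \<star> e 3 = e 1"
  by (simp_all add: oct_mult_coords vec_eq_8 e_nth)

section \<open>Alternativity and the inner product\<close>

lemma inner_8: "x \<bullet> y = x$0*y$0 + x$1*y$1 + x$2*y$2 + x$3*y$3 + x$4*y$4 + x$5*y$5 + x$6*y$6 + x$7*y$7" for x y :: "real^8"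
  by (simp add: inner_vec_def sum_8)

text \<open>Polarised form of \<open>x \<star> (x \<star> z) = (x \<star> x) \<star> z\<close>, the
  substitute for associativity.\<close>

lemma oct_left_alternative: "x \<star> (y \<star> z) + y \<star> (x \<star> z) = (x \<star> y + y \<star> x) \<star> z"
  by (simp add: oct_mult_coords vec_eq_8 algebra_simps)

lemma oct_right_alternative: "(x \<star> y) \<star> z + (x \<star> z) \<star> y = x \<star> (y \<star> z + z \<star> y)"
  by (simp add: oct_mult_coords vec_eq_8 algebra_simps)

lemma oct_anticommute:
  "x \<star> y + y \<star> x = (2 * x $ 0) *\<^sub>R y + (2 * y $ 0) *\<^sub>R x - (2 * (x \<bullet> y)) *\<^sub>R e 0"
  by (simp add: oct_mult_coords vec_eq_8 algebra_simps inner_8 e_nth)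

text \<open>The adjoint of left multiplication by \<open>x\<close> is left multiplication by the
  conjugate of \<open>x\<close>, written here as
  \<open>(2 * x $ 0) *\<^sub>R e 0 - x\<close>.\<close>

lemma oct_inner_mult_left: "(x \<star> y) \<bullet> z = y \<bullet> (((2 * x $ 0) *\<^sub>R e 0 - x) \<star> z)"
  by (simp add: oct_mult_coords vec_eq_8 algebra_simps inner_8 e_nth)

lemma oct_inner_mult_right: "(x \<star> y) \<bullet> z = x \<bullet> (z \<star> ((2 * y $ 0) *\<^sub>R e 0 - y))"
  by (simp add: oct_mult_coords vec_eq_8 algebra_simps inner_8 e_nth)

section \<open>Root coordinates on the derivation algebra\<close>

lemma g2_mult: "D \<in> g2 \<Longrightarrow> D *v (x \<star> y) = (D *v x) \<star> y + x \<star> (D *v y)"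
  by (simp add: g2_def)

lemma subspace_g2: "subspace g2"
  unfolding subspace_def g2_def
  by (auto simp: matrix_vector_mult_add_rdistrib scaleR_matrix_vector_assoc[symmetric] oct_mult_linear algebra_simps)

lemma lie_subalgebra_g2: "lie_subalgebra g2"
  unfolding lie_subalgebra_def
proof (intro conjI ballI subspace_g2)
  fix X Y assume "X \<in> g2" "Y \<in> g2"
  then show "lie_bracket X Y \<in> g2"
    by (simp add: g2_def lie_bracket_def matrix_vector_mult_diff_rdistrib matrix_vector_mul_assoc[symmetric]
        oct_mult_linear matrix_vector_right_distrib)
qed

lemma mv_minus: "A *v (- x) = - (A *v x)" for A :: "real^'n^'m"
  using matrix_vector_mult_diff_distrib[of A 0 x] by simp

lemma g2_e0: assumes "D \<in> g2" shows "D *v e 0 = 0"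
  using g2_mult[OF assms, of "e 0" "e 0"] by simp

lemma matrix_eq_columns: fixes A B :: "real^'n^'m"
  assumes "\<And>i. A *v axis i 1 = B *v axis i 1" shows "A = B"
  using assms by (simp add: vec_eq_iff matrix_vector_mult_basis column_def)

text \<open>\<open>e 1\<close>, \<open>e 2\<close>, \<open>e 4\<close> generate the octonions, so
  the Leibniz rule determines a derivation by these three values.\<close>

lemma g2_eqI:
  assumes D: "D \<in> g2" "D' \<in> g2"
    and eq: "D *v e 1 = D' *v e 1" "D *v e 2 = D' *v e 2" "D *v e 4 = D' *v e 4"
  shows "D = D'"
proof -
  have e3: "D *v e 3 = D' *v e 3"
    using g2_mult[OF D(1), of "e 1" "e 2"] g2_mult[OF D(2), of "e 1" "e 2"] eq by (simp add: e_mult_table)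
  have e5: "D *v e 5 = D' *v e 5"
    using g2_mult[OF D(1), of "e 1" "e 4"] g2_mult[OF D(2), of "e 1" "e 4"] eq by (simp add: e_mult_table)
  have e6: "D *v e 6 = D' *v e 6"
    using g2_mult[OF D(1), of "e 2" "e 4"] g2_mult[OF D(2), of "e 2" "e 4"] eq by (simp add: e_mult_table)
  have e7: "D *v e 7 = D' *v e 7"
    using g2_mult[OF D(1), of "e 3" "e 4"] g2_mult[OF D(2), of "e 3" "e 4"] eq e3 by (simp add: e_mult_table)
  have "\<forall>i. D *v e i = D' *v e i"
    unfolding forall_8 using eq e3 e5 e6 e7 g2_e0[OF D(1)] g2_e0[OF D(2)] by simp
  then show ?thesis
    by (intro matrix_eq_columns) (simp add: e_def)
qed

text \<open>Root coordinates for the torus that rotates the planes of \<open>(e 2, e 3)\<close>, \<open>(e 4, e 5)\<close>, \<open>(e 6, e 7)\<close> with speeds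
  \<open>Re t\<close>, \<open>Im t\<close>, \<open>Re t + Im t\<close>: \<open>x\<^sub>k\<close> is the coordinate on a short root plane, \<open>l\<^sub>j\<^sub>k\<close> on a long one, with complex
  structures for which the torus acts by imaginary scalars.\<close>

definition gmat :: "complex \<Rightarrow> complex \<Rightarrow> complex \<Rightarrow> complex \<Rightarrow> complex \<Rightarrow> complex \<Rightarrow> complex \<Rightarrow> endo"
  where "gmat x1 x2 x3 l12 l13 l23 t = (vec8
     (vec8 0 0 0 0 0 0 0 0)
     (vec8 0 0 (- 2 * Re x1) (- 2 * Im x1) (- 2 * Re x2) (- 2 * Im x2) (- 2 * Re x3) (- 2 * Im x3))
     (vec8 0 (2 * Re x1) 0 (- Re t) (Im x3 - Re l12) (- Re x3 - Im l12) (Im x2 + Im l13) (- Re x2 - Re l13))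
     (vec8 0 (2 * Im x1) (Re t) 0 (- Re x3 + Im l12) (- Im x3 - Re l12) (Re x2 - Re l13) (Im x2 - Im l13))
     (vec8 0 (2 * Re x2) (- Im x3 + Re l12) (Re x3 - Im l12) 0 (- Im t) (- Im x1 + Im l23) (Re x1 - Re l23))
     (vec8 0 (2 * Im x2) (Re x3 + Im l12) (Im x3 + Re l12) (Im t) 0 (- Re x1 - Re l23) (- Im x1 - Im l23))
     (vec8 0 (2 * Re x3) (- Im x2 - Im l13) (- Re x2 + Re l13) (Im x1 - Im l23) (Re x1 + Re l23) 0 (- Re t - Im t))
     (vec8 0 (2 * Im x3) (Re x2 + Re l13) (- Im x2 + Im l13) (- Re x1 + Re l23) (Im x1 + Im l23) (Re t + Im t) 0))"

lemma gmat_add: "gmat x1 x2 x3 l12 l13 l23 t + gmat x1' x2' x3' l12' l13' l23' t'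
    = gmat (x1 + x1') (x2 + x2') (x3 + x3') (l12 + l12') (l13 + l13') (l23 + l23') (t + t')"
  by (simp add: gmat_def vec_eq_8)

lemma gmat_scaleR: "c *\<^sub>R gmat x1 x2 x3 l12 l13 l23 t
    = gmat (c *\<^sub>R x1) (c *\<^sub>R x2) (c *\<^sub>R x3) (c *\<^sub>R l12) (c *\<^sub>R l13) (c *\<^sub>R l23) (c *\<^sub>R t)"
  by (simp add: gmat_def vec_eq_8 algebra_simps)

lemma gmat_apply:
  "gmat x1 x2 x3 l12 l13 l23 t *v e 1 = vec8 0 0 (2 * Re x1) (2 * Im x1) (2 * Re x2) (2 * Im x2) (2 * Re x3) (2 * Im x3)"
  "gmat x1 x2 x3 l12 l13 l23 t *v e 2 = vec8 0 (- 2 * Re x1) 0 (Re t) (- Im x3 + Re l12) (Re x3 + Im l12)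
     (- Im x2 - Im l13) (Re x2 + Re l13)"
  "gmat x1 x2 x3 l12 l13 l23 t *v e 4 = vec8 0 (- 2 * Re x2) (Im x3 - Re l12) (- Re x3 + Im l12) 0 (Im t)
     (Im x1 - Im l23) (- Re x1 + Re l23)"
  by (simp_all add: matrix_vector_8 gmat_def e_nth)

lemma gmat_in_g2: "gmat x1 x2 x3 l12 l13 l23 t \<in> g2"
  by (simp add: g2_def matrix_vector_8 gmat_def oct_mult_coords vec_eq_8 algebra_simps)

text \<open>Differentiating the squares of \<open>e 1\<close>, \<open>e 2\<close>,
  \<open>e 4\<close>, their anticommutation, and that of \<open>e 3\<close> with \<open>e 4\<close>
  gives ten linear relations on the 24 entries of three columns; fourteen real parameters
  remain.\<close>

lemma g2_gmat:
  assumes D: "D \<in> g2"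
  obtains x1 x2 x3 l12 l13 l23 t where "D = gmat x1 x2 x3 l12 l13 l23 t"
proof -
  define a where "a = D *v e 1"
  define b where "b = D *v e 2"
  define c where "c = D *v e 4"
  have sq: "a \<star> e 1 + e 1 \<star> a = 0" "b \<star> e 2 + e 2 \<star> b = 0" "c \<star> e 4 + e 4 \<star> c = 0"
    using g2_mult[OF D, of "e 1" "e 1"] g2_mult[OF D, of "e 2" "e 2"] g2_mult[OF D, of "e 4" "e 4"] g2_e0[OF D]
    by (simp_all add: e_mult_table a_def b_def c_def mv_minus)
  have symm: "(D *v x) \<star> y + x \<star> (D *v y) + ((D *v y) \<star> x + y \<star> (D *v x)) = D *v (x \<star> y + y \<star> x)" for x y
    by (simp add: matrix_vector_right_distrib g2_mult[OF D])
  have anti: "a \<star> e 2 + e 1 \<star> b + (b \<star> e 1 + e 2 \<star> a) = 0"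
     "a \<star> e 4 + e 1 \<star> c + (c \<star> e 1 + e 4 \<star> a) = 0"
     "b \<star> e 4 + e 2 \<star> c + (c \<star> e 2 + e 4 \<star> b) = 0"
    using symm[of "e 1" "e 2"] symm[of "e 1" "e 4"] symm[of "e 2" "e 4"]
    by (simp_all add: e_mult_table a_def b_def c_def)
  have "D *v e 3 = a \<star> e 2 + e 1 \<star> b"
    using g2_mult[OF D, of "e 1" "e 2"] by (simp add: e_mult_table a_def b_def)
  then have anti34: "(a \<star> e 2 + e 1 \<star> b) \<star> e 4 + e 3 \<star> c + (c \<star> e 3 + e 4 \<star> (a \<star> e 2 + e 1 \<star> b)) = 0"
    using symm[of "e 3" "e 4"] by (simp add: e_mult_table c_def)
  \<comment> \<open>The parameters solve the equations of \<open>gmat_apply\<close> for the entries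
    of \<open>a\<close>, \<open>b\<close>, \<open>c\<close>.\<close>
  have "D = gmat (Complex (a$2/2) (a$3/2)) (Complex (a$4/2) (a$5/2)) (Complex (a$6/2) (a$7/2))
     (Complex (b$4 + a$7/2) (b$5 - a$6/2)) (Complex (b$7 - a$4/2) (- b$6 - a$5/2))
     (Complex (c$7 + a$2/2) (a$3/2 - c$6)) (Complex (b$3) (c$5))"
    (is "_ = ?G")
  proof (rule g2_eqI[OF D gmat_in_g2])
    show "D *v e 1 = ?G *v e 1" "D *v e 2 = ?G *v e 2" "D *v e 4 = ?G *v e 4"
      unfolding gmat_apply a_def[symmetric] b_def[symmetric] c_def[symmetric]
      using sq anti anti34 by (simp_all add: oct_mult_coords vec_eq_8 e_nth)
  qed
  then show ?thesis by (rule that)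
qed

text \<open>The real factors next to \<open>\<i>\<close> are the roots evaluated at
  \<open>\<omega>\<close>; the long ones are a difference and two sums of short ones.\<close>

lemma lie_bracket_torus:
  "lie_bracket (gmat 0 0 0 0 0 0 \<omega>) (gmat x1 x2 x3 l12 l13 l23 t) =
   gmat (\<i> * of_real (Re \<omega>) * x1) (\<i> * of_real (Im \<omega>) * x2) (\<i> * of_real (Re \<omega> + Im \<omega>) * x3)
     (\<i> * of_real (Im \<omega> - Re \<omega>) * l12) (\<i> * of_real (2 * Re \<omega> + Im \<omega>) * l13)
     (\<i> * of_real (Re \<omega> + 2 * Im \<omega>) * l23) 0"
proof (rule g2_eqI[OF _ gmat_in_g2])
  show "lie_bracket (gmat 0 0 0 0 0 0 \<omega>) (gmat x1 x2 x3 l12 l13 l23 t) \<in> g2"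
    using lie_subalgebra_g2 gmat_in_g2 unfolding lie_subalgebra_def by blast
qed (simp_all add: lie_bracket_def matrix_vector_mult_diff_rdistrib matrix_vector_mul_assoc[symmetric] gmat_apply,
     simp_all add: matrix_vector_8 gmat_def vec_eq_8 algebra_simps)

text \<open>Sample brackets of root vectors. The first two give independent torus directions; the
  others have nonzero components in the planes of sums and differences of the two roots, and nonzero
  is all that is needed of them.\<close>

lemma gmat_brackets:
  "lie_bracket (gmat (Complex (1) (0)) 0 0 0 0 0 0)
     (gmat (Complex (0) (1)) 0 0 0 0 0 0)
   = gmat 0 0 0 0 0 0 (Complex (4) (-2))"
  "lie_bracket (gmat 0 (Complex (1) (0)) 0 0 0 0 0)
     (gmat 0 (Complex (0) (1)) 0 0 0 0 0)
   = gmat 0 0 0 0 0 0 (Complex (-2) (4))"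
  "lie_bracket (gmat (Complex (1) (0)) 0 0 0 0 0 0)
     (gmat 0 (Complex (1) (0)) 0 0 0 0 0)
   = gmat 0 0 (Complex (0) (-2)) (Complex (3) (0)) 0 0 0"
  "lie_bracket (gmat (Complex (1) (0)) 0 0 0 0 0 0)
     (gmat 0 0 (Complex (1) (0)) 0 0 0 0)
   = gmat 0 (Complex (0) (-2)) 0 0 (Complex (0) (-3)) 0 0"
  "lie_bracket (gmat 0 (Complex (1) (0)) 0 0 0 0 0)
     (gmat 0 0 (Complex (1) (0)) 0 0 0 0)
   = gmat (Complex (0) (2)) 0 0 0 0 (Complex (0) (-3)) 0"
  "lie_bracket (gmat (Complex (1) (0)) 0 0 0 0 0 0)
     (gmat 0 0 0 (Complex (1) (0)) 0 0 0)
   = gmat 0 (Complex (-1) (0)) 0 0 0 0 0"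
  "lie_bracket (gmat (Complex (1) (0)) 0 0 0 0 0 0)
     (gmat 0 0 0 0 (Complex (1) (0)) 0 0)
   = gmat 0 0 (Complex (0) (-1)) 0 0 0 0"
  "lie_bracket (gmat 0 (Complex (1) (0)) 0 0 0 0 0)
     (gmat 0 0 0 (Complex (1) (0)) 0 0 0)
   = gmat (Complex (1) (0)) 0 0 0 0 0 0"
  "lie_bracket (gmat 0 (Complex (1) (0)) 0 0 0 0 0)
     (gmat 0 0 0 0 0 (Complex (1) (0)) 0)
   = gmat 0 0 (Complex (0) (-1)) 0 0 0 0"
  "lie_bracket (gmat 0 0 (Complex (1) (0)) 0 0 0 0)
     (gmat 0 0 0 0 (Complex (1) (0)) 0 0)
   = gmat (Complex (0) (1)) 0 0 0 0 0 0"
  "lie_bracket (gmat 0 0 (Complex (1) (0)) 0 0 0 0)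
     (gmat 0 0 0 0 0 (Complex (1) (0)) 0)
   = gmat 0 (Complex (0) (1)) 0 0 0 0 0"

  by (rule g2_eqI[OF _ gmat_in_g2];
      (use lie_subalgebra_g2 gmat_in_g2 in \<open>unfold lie_subalgebra_def, blast\<close>)?;
      simp add: lie_bracket_def matrix_vector_mult_diff_rdistrib matrix_vector_mul_assoc[symmetric] gmat_apply;
      simp add: matrix_vector_8 gmat_def vec_eq_8)+

section \<open>Subalgebras containing a generic torus element\<close>

text \<open>\<open>B - c k\<close> kills the component \<open>v k\<close> and multiplies every other
  one by a nonzero number, so induction applies to the rescaled family; \<open>v k\<close> is then
  what remains of the sum.\<close>

lemma eigencomponents_in_invariant_subspace:
  fixes B :: "'a::real_vector \<Rightarrow> 'a"
  assumes "linear B" "subspace S" "\<And>x. x \<in> S \<Longrightarrow> B x \<in> S"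
    and "finite I" "inj_on c I" "\<And>i. i \<in> I \<Longrightarrow> B (v i) = c i *\<^sub>R v i" "sum v I \<in> S" "i \<in> I"
  shows "v i \<in> S"
  using assms(4-)
proof (induction I arbitrary: v i rule: finite_induct)
  case (insert k I)
  have "B (sum v (insert k I)) - c k *\<^sub>R sum v (insert k I) \<in> S"
    using assms(2,3) insert.prems by (intro subspace_diff subspace_scale) auto
  also have "B (sum v (insert k I)) - c k *\<^sub>R sum v (insert k I) = (\<Sum>i\<in>I. (c i - c k) *\<^sub>R v i)"
    using insert.hyps insert.prems(2)
    by (simp add: linear_sum[OF assms(1)] linear_add[OF assms(1)] scaleR_sum_right scaleR_add_right
        scaleR_left_diff_distrib sum_subtractf)
  finally have "(\<Sum>i\<in>I. (c i - c k) *\<^sub>R v i) \<in> S" .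
  then have scaled: "(c j - c k) *\<^sub>R v j \<in> S" if "j \<in> I" for j
    using insert.IH[of "\<lambda>i. (c i - c k) *\<^sub>R v i"] insert.prems(1,2) that
    by (simp add: linear_scale[OF assms(1)])
  have rest: "v j \<in> S" if "j \<in> I" for j
  proof -
    have "c j \<noteq> c k" using insert.prems(1) insert.hyps that by (auto simp: inj_on_def)
    then show ?thesis using subspace_scale[OF assms(2) scaled[OF that], of "1 / (c j - c k)"] by simp
  qed
  have "sum v (insert k I) - sum v I \<in> S"
    by (intro subspace_diff[OF assms(2) insert.prems(3)] subspace_sum[OF assms(2)] rest)
  then have "v k \<in> S" using insert.hyps by simp
  then show ?case using rest insert.prems by auto
qed simp

lemma linear_lie_bracket: "linear (lie_bracket X)"
  by (rule linearI) (simp_all add: lie_bracket_def vec_eq_iff matrix_matrix_mult_def sum.distrib sum_distrib_left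
      sum_subtractf algebra_simps)

text \<open>The speeds are those of \<open>Z_der (e 1) (sqrt 2 *\<^sub>R e 1)\<close>.\<close>

definition \<tau> :: complex where "\<tau> = Complex 2 (sqrt 2 - 1)"

definition Z0 :: endo where "Z0 = gmat 0 0 0 0 0 0 \<tau>"

lemma sqrt2_bounds: "1.41 < sqrt 2" "sqrt 2 < 1.42"
  by (rule real_less_rsqrt, simp add: power2_eq_square) (rule real_less_lsqrt, simp_all add: power2_eq_square)

text \<open>The square of the adjoint action is real and diagonal, with minus the squared
  frequencies as eigenvalues, so root planes can be separated without complexification.\<close>

lemma lie_bracket_Z0_twice:
  "lie_bracket Z0 (lie_bracket Z0 (gmat x1 x2 x3 l12 l13 l23 t)) =
    gmat (- 4 *\<^sub>R x1) ((2 * sqrt 2 - 3) *\<^sub>R x2) (- (3 + 2 * sqrt 2) *\<^sub>R x3)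
      ((6 * sqrt 2 - 11) *\<^sub>R l12) (- (11 + 6 * sqrt 2) *\<^sub>R l13) (- 8 *\<^sub>R l23) 0"
proof -
  have i: "\<i> * of_real r * (\<i> * of_real r * x) = (- (r\<^sup>2)) *\<^sub>R x" for r x
    by (simp add: complex_eq_iff power2_eq_square)
  have s: "(sqrt 2 - 1)\<^sup>2 = 3 - 2 * sqrt 2" "(2 + (sqrt 2 - 1))\<^sup>2 = 3 + 2 * sqrt 2"
    "(sqrt 2 - 1 - 2)\<^sup>2 = 11 - 6 * sqrt 2" "(2 * 2 + (sqrt 2 - 1))\<^sup>2 = 11 + 6 * sqrt 2"
    "(2 + 2 * (sqrt 2 - 1))\<^sup>2 = 8"
    by (simp_all add: power2_eq_square algebra_simps)
  show ?thesis
    unfolding Z0_def lie_bracket_torus i \<tau>_def complex.sel s by simp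
qed

lemma root_components:
  assumes L: "subspace L" "\<And>X. X \<in> L \<Longrightarrow> lie_bracket Z0 X \<in> L"
    and mem: "gmat x1 x2 x3 l12 l13 l23 t \<in> L"
  shows "gmat x1 0 0 0 0 0 0 \<in> L" "gmat 0 x2 0 0 0 0 0 \<in> L" "gmat 0 0 x3 0 0 0 0 \<in> L"
    "gmat 0 0 0 l12 0 0 0 \<in> L" "gmat 0 0 0 0 l13 0 0 \<in> L" "gmat 0 0 0 0 0 l23 0 \<in> L"
    "gmat 0 0 0 0 0 0 t \<in> L"
proof -
  define v where "v = nth [gmat x1 0 0 0 0 0 0, gmat 0 x2 0 0 0 0 0, gmat 0 0 x3 0 0 0 0,
    gmat 0 0 0 l12 0 0 0, gmat 0 0 0 0 l13 0 0, gmat 0 0 0 0 0 l23 0, gmat 0 0 0 0 0 0 t]"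
  \<comment> \<open>The eigenvalues on the seven components, with 0 for the torus; the choice of
    \<open>\<tau>\<close> makes them distinct.\<close>
  define c where "c = nth [- 4, 2 * sqrt 2 - 3, - (3 + 2 * sqrt 2), 6 * sqrt 2 - 11, - (11 + 6 * sqrt 2), - 8, 0]"
  let ?B = "\<lambda>X. lie_bracket Z0 (lie_bracket Z0 X)"
  have set7: "{..<7::nat} = {0,1,2,3,4,5,6}" by auto
  have lin: "linear ?B"
    using linear_compose[OF linear_lie_bracket linear_lie_bracket, of Z0 Z0] by (simp add: o_def)
  have "distinct [- 4, 2 * sqrt 2 - 3, - (3 + 2 * sqrt 2), 6 * sqrt 2 - 11, - (11 + 6 * sqrt 2), - 8, 0]"
    using sqrt2_bounds by simp
  then have inj: "inj_on c {..<7}"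
    unfolding c_def by (rule inj_on_nth) auto
  have eig: "?B (v i) = c i *\<^sub>R v i" if "i \<in> {..<7}" for i
    using that unfolding set7 by (auto simp: v_def c_def lie_bracket_Z0_twice gmat_scaleR)
  have sum: "sum v {..<7} \<in> L"
    using mem unfolding set7 by (simp add: v_def gmat_add)
  have all: "v i \<in> L" if "i \<in> {..<7}" for i
    by (rule eigencomponents_in_invariant_subspace[OF lin L(1) _ _ inj eig sum that]) (use L(2) in auto)
  show "gmat x1 0 0 0 0 0 0 \<in> L" "gmat 0 x2 0 0 0 0 0 \<in> L" "gmat 0 0 x3 0 0 0 0 \<in> L"
    "gmat 0 0 0 l12 0 0 0 \<in> L" "gmat 0 0 0 0 l13 0 0 \<in> L" "gmat 0 0 0 0 0 l23 0 \<in> L"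
    "gmat 0 0 0 0 0 0 t \<in> L"
    using all[of 0] all[of 1] all[of 2] all[of 3] all[of 4] all[of 5] all[of 6] by (simp_all add: v_def)
qed

text \<open>\<open>x\<close> and its quarter turn span the plane over the reals; the coefficients of
  \<open>y\<close> are the real and imaginary parts of \<open>y / x\<close>, the latter corrected by
  the speed \<open>w\<close>.\<close>

lemma full_complex_plane:
  fixes f :: "complex \<Rightarrow> 'a::real_vector"
  assumes add: "\<And>x y. f (x + y) = f x + f y" and scale: "\<And>c x. f (c *\<^sub>R x) = c *\<^sub>R f x"
    and S: "subspace S" "\<And>x. f x \<in> S \<Longrightarrow> f (\<i> * of_real w * x) \<in> S" and "w \<noteq> 0" "x \<noteq> 0" "f x \<in> S"
  shows "f y \<in> S"
proof -
  define q where "q = y / x"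
  have "y = Re q *\<^sub>R x + (Im q / w) *\<^sub>R (\<i> * of_real w * x)"
  proof -
    have "Re q *\<^sub>R x + (Im q / w) *\<^sub>R (\<i> * of_real w * x) = (of_real (Re q) + \<i> * of_real (Im q)) * x"
      using \<open>w \<noteq> 0\<close> by (simp add: scaleR_conv_of_real field_simps)
    also have "\<dots> = y" using \<open>x \<noteq> 0\<close> by (simp add: complex_eq[symmetric] q_def)
    finally show ?thesis by simp
  qed
  then have "f y = f (Re q *\<^sub>R x + (Im q / w) *\<^sub>R (\<i> * of_real w * x))"
    by (rule arg_cong)
  then have "f y = Re q *\<^sub>R f x + (Im q / w) *\<^sub>R f (\<i> * of_real w * x)"
    by (simp only: add scale)
  then show ?thesis
    using S assms(7) by (simp add: subspace_add subspace_scale)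
qed

text \<open>\<open>H45\<close> and \<open>H67\<close> are the quaternion algebras spanned by
  \<open>e 0\<close>, \<open>e 1\<close> and one further plane rotated by the torus, companions of
  \<open>H_A\<close>.\<close>

definition H45 :: "(real^8) set" where "H45 = {x. x$2 = 0 \<and> x$3 = 0 \<and> x$6 = 0 \<and> x$7 = 0}"
definition H67 :: "(real^8) set" where "H67 = {x. x$2 = 0 \<and> x$3 = 0 \<and> x$4 = 0 \<and> x$5 = 0}"

text \<open>The root system of \<open>g2\<close>, with \<open>x\<^sub>k\<close> the short and \<open>l\<^sub>j\<^sub>k\<close> the long roots: a proper closed subsystem has no
  short roots, or is contained in an orthogonal pair of a short and a long root.\<close>

lemma subalgebra_containing_Z0:
  assumes L: "lie_subalgebra L" "L \<subseteq> g2" and Z0: "Z0 \<in> L"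
  shows "L = g2 \<or> (\<forall>D\<in>L. D *v e 1 = 0) \<or> L \<subseteq> \<kk> H_A \<or> L \<subseteq> \<kk> H45 \<or> L \<subseteq> \<kk> H67"
proof -
  have sub: "subspace L" and br: "\<And>X Y. X \<in> L \<Longrightarrow> Y \<in> L \<Longrightarrow> lie_bracket X Y \<in> L"
    using L(1) by (auto simp: lie_subalgebra_def)
  have brZ: "lie_bracket Z0 X \<in> L" if "X \<in> L" for X using br[OF Z0 that] .
  have comp: "gmat x1 0 0 0 0 0 0 \<in> L" "gmat 0 x2 0 0 0 0 0 \<in> L" "gmat 0 0 x3 0 0 0 0 \<in> L"
    "gmat 0 0 0 l12 0 0 0 \<in> L" "gmat 0 0 0 0 l13 0 0 \<in> L" "gmat 0 0 0 0 0 l23 0 \<in> L"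
    if m: "gmat x1 x2 x3 l12 l13 l23 t \<in> L" for x1 x2 x3 l12 l13 l23 t
    by (rule root_components[OF sub _ m], erule brZ)+
  \<comment> \<open>Each flag says that a whole root plane lies in \<open>L\<close>; by
    \<open>K0\<close> to \<open>K5\<close> one nonzero vector of the plane suffices.\<close>
  define f1 where "f1 \<longleftrightarrow> (\<forall>y. gmat y 0 0 0 0 0 0 \<in> L)"
  define f2 where "f2 \<longleftrightarrow> (\<forall>y. gmat 0 y 0 0 0 0 0 \<in> L)"
  define f3 where "f3 \<longleftrightarrow> (\<forall>y. gmat 0 0 y 0 0 0 0 \<in> L)"
  define f12 where "f12 \<longleftrightarrow> (\<forall>y. gmat 0 0 0 y 0 0 0 \<in> L)"
  define f13 where "f13 \<longleftrightarrow> (\<forall>y. gmat 0 0 0 0 y 0 0 \<in> L)"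
  define f23 where "f23 \<longleftrightarrow> (\<forall>y. gmat 0 0 0 0 0 y 0 \<in> L)"
  note f_defs = f1_def f2_def f3_def f12_def f13_def f23_def
  have w: "2 \<noteq> (0::real)" "sqrt 2 - 1 \<noteq> 0" "2 + (sqrt 2 - 1) \<noteq> 0" "sqrt 2 - 1 - 2 \<noteq> 0"
    "2 * 2 + (sqrt 2 - 1) \<noteq> 0" "2 + 2 * (sqrt 2 - 1) \<noteq> 0"
    using sqrt2_bounds by auto
  note torus = lie_bracket_torus[of \<tau>, folded Z0_def, unfolded \<tau>_def complex.sel]
  have rot0: "gmat (\<i> * of_real 2 * x) 0 0 0 0 0 0 \<in> L" if "gmat x 0 0 0 0 0 0 \<in> L" for x
    using brZ[OF that] unfolding torus by simp
  have K0: "f1" if "gmat x 0 0 0 0 0 0 \<in> L" "x \<noteq> 0" for x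
    unfolding f1_def
  proof
    fix y show "gmat y 0 0 0 0 0 0 \<in> L"
      using full_complex_plane[where f = "\<lambda>z. gmat z 0 0 0 0 0 0" and S = L and w = "2" and x = x and y = y]
        rot0 w(1) sub that
      by (simp add: gmat_add gmat_scaleR)
  qed
  have rot1: "gmat 0 (\<i> * of_real (sqrt 2 - 1) * x) 0 0 0 0 0 \<in> L" if "gmat 0 x 0 0 0 0 0 \<in> L" for x
    using brZ[OF that] unfolding torus by simp
  have K1: "f2" if "gmat 0 x 0 0 0 0 0 \<in> L" "x \<noteq> 0" for x
    unfolding f2_def
  proof
    fix y show "gmat 0 y 0 0 0 0 0 \<in> L"
      using full_complex_plane[where f = "\<lambda>z. gmat 0 z 0 0 0 0 0" and S = L and w = "(sqrt 2 - 1)" and x = x and y = y]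
        rot1 w(2) sub that
      by (simp add: gmat_add gmat_scaleR)
  qed
  have rot2: "gmat 0 0 (\<i> * of_real (2 + (sqrt 2 - 1)) * x) 0 0 0 0 \<in> L" if "gmat 0 0 x 0 0 0 0 \<in> L" for x
    using brZ[OF that] unfolding torus by simp
  have K2: "f3" if "gmat 0 0 x 0 0 0 0 \<in> L" "x \<noteq> 0" for x
    unfolding f3_def
  proof
    fix y show "gmat 0 0 y 0 0 0 0 \<in> L"
      using full_complex_plane[where f = "\<lambda>z. gmat 0 0 z 0 0 0 0" and S = L and w = "(2 + (sqrt 2 - 1))" and x = x and y = y]
        rot2 w(3) sub that
      by (simp add: gmat_add gmat_scaleR)
  qed
  have rot3: "gmat 0 0 0 (\<i> * of_real (sqrt 2 - 1 - 2) * x) 0 0 0 \<in> L" if "gmat 0 0 0 x 0 0 0 \<in> L" for x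
    using brZ[OF that] unfolding torus by simp
  have K3: "f12" if "gmat 0 0 0 x 0 0 0 \<in> L" "x \<noteq> 0" for x
    unfolding f12_def
  proof
    fix y show "gmat 0 0 0 y 0 0 0 \<in> L"
      using full_complex_plane[where f = "\<lambda>z. gmat 0 0 0 z 0 0 0" and S = L and w = "(sqrt 2 - 1 - 2)" and x = x and y = y]
        rot3 w(4) sub that
      by (simp add: gmat_add gmat_scaleR)
  qed
  have rot4: "gmat 0 0 0 0 (\<i> * of_real (2 * 2 + (sqrt 2 - 1)) * x) 0 0 \<in> L" if "gmat 0 0 0 0 x 0 0 \<in> L" for x
    using brZ[OF that] unfolding torus by simp
  have K4: "f13" if "gmat 0 0 0 0 x 0 0 \<in> L" "x \<noteq> 0" for x
    unfolding f13_def
  proof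
    fix y show "gmat 0 0 0 0 y 0 0 \<in> L"
      using full_complex_plane[where f = "\<lambda>z. gmat 0 0 0 0 z 0 0" and S = L and w = "(2 * 2 + (sqrt 2 - 1))" and x = x and y = y]
        rot4 w(5) sub that
      by (simp add: gmat_add gmat_scaleR)
  qed
  have rot5: "gmat 0 0 0 0 0 (\<i> * of_real (2 + 2 * (sqrt 2 - 1)) * x) 0 \<in> L" if "gmat 0 0 0 0 0 x 0 \<in> L" for x
    using brZ[OF that] unfolding torus by simp
  have K5: "f23" if "gmat 0 0 0 0 0 x 0 \<in> L" "x \<noteq> 0" for x
    unfolding f23_def
  proof
    fix y show "gmat 0 0 0 0 0 y 0 \<in> L"
      using full_complex_plane[where f = "\<lambda>z. gmat 0 0 0 0 0 z 0" and S = L and w = "(2 + 2 * (sqrt 2 - 1))" and x = x and y = y]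
        rot5 w(6) sub that
      by (simp add: gmat_add gmat_scaleR)
  qed
  \<comment> \<open>Closure rules for the flags: two short roots give the third short one and a long
    one, and a short root with a long root not orthogonal to it gives another short root.\<close>
  have c_f1_f2: "f3 \<and> f12" if f1 f2
  proof -
    have m: "lie_bracket (gmat (Complex 1 0) 0 0 0 0 0 0) (gmat 0 (Complex 1 0) 0 0 0 0 0) \<in> L"
      using that unfolding f1_def f2_def by (intro br) blast+
    show ?thesis
      using K2[OF comp(3)[OF m[unfolded gmat_brackets]]] K3[OF comp(4)[OF m[unfolded gmat_brackets]]]
      by (simp add: complex_eq_iff)
  qed
  have c_f1_f3: "f2 \<and> f13" if f1 f3
  proof -
    have m: "lie_bracket (gmat (Complex 1 0) 0 0 0 0 0 0) (gmat 0 0 (Complex 1 0) 0 0 0 0) \<in> L"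
      using that unfolding f1_def f3_def by (intro br) blast+
    show ?thesis
      using K1[OF comp(2)[OF m[unfolded gmat_brackets]]] K4[OF comp(5)[OF m[unfolded gmat_brackets]]]
      by (simp add: complex_eq_iff)
  qed
  have c_f2_f3: "f1 \<and> f23" if f2 f3
  proof -
    have m: "lie_bracket (gmat 0 (Complex 1 0) 0 0 0 0 0) (gmat 0 0 (Complex 1 0) 0 0 0 0) \<in> L"
      using that unfolding f2_def f3_def by (intro br) blast+
    show ?thesis
      using K0[OF comp(1)[OF m[unfolded gmat_brackets]]] K5[OF comp(6)[OF m[unfolded gmat_brackets]]]
      by (simp add: complex_eq_iff)
  qed
  have c_f1_f12: "f2" if f1 f12
  proof -
    have m: "lie_bracket (gmat (Complex 1 0) 0 0 0 0 0 0) (gmat 0 0 0 (Complex 1 0) 0 0 0) \<in> L"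
      using that unfolding f1_def f12_def by (intro br) blast+
    show ?thesis
      using K1[OF comp(2)[OF m[unfolded gmat_brackets]]]
      by (simp add: complex_eq_iff)
  qed
  have c_f1_f13: "f3" if f1 f13
  proof -
    have m: "lie_bracket (gmat (Complex 1 0) 0 0 0 0 0 0) (gmat 0 0 0 0 (Complex 1 0) 0 0) \<in> L"
      using that unfolding f1_def f13_def by (intro br) blast+
    show ?thesis
      using K2[OF comp(3)[OF m[unfolded gmat_brackets]]]
      by (simp add: complex_eq_iff)
  qed
  have c_f2_f12: "f1" if f2 f12
  proof -
    have m: "lie_bracket (gmat 0 (Complex 1 0) 0 0 0 0 0) (gmat 0 0 0 (Complex 1 0) 0 0 0) \<in> L"
      using that unfolding f2_def f12_def by (intro br) blast+
    show ?thesis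
      using K0[OF comp(1)[OF m[unfolded gmat_brackets]]]
      by (simp add: complex_eq_iff)
  qed
  have c_f2_f23: "f3" if f2 f23
  proof -
    have m: "lie_bracket (gmat 0 (Complex 1 0) 0 0 0 0 0) (gmat 0 0 0 0 0 (Complex 1 0) 0) \<in> L"
      using that unfolding f2_def f23_def by (intro br) blast+
    show ?thesis
      using K2[OF comp(3)[OF m[unfolded gmat_brackets]]]
      by (simp add: complex_eq_iff)
  qed
  have c_f3_f13: "f1" if f3 f13
  proof -
    have m: "lie_bracket (gmat 0 0 (Complex 1 0) 0 0 0 0) (gmat 0 0 0 0 (Complex 1 0) 0 0) \<in> L"
      using that unfolding f3_def f13_def by (intro br) blast+
    show ?thesis
      using K0[OF comp(1)[OF m[unfolded gmat_brackets]]]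
      by (simp add: complex_eq_iff)
  qed
  have c_f3_f23: "f2" if f3 f23
  proof -
    have m: "lie_bracket (gmat 0 0 (Complex 1 0) 0 0 0 0) (gmat 0 0 0 0 0 (Complex 1 0) 0) \<in> L"
      using that unfolding f3_def f23_def by (intro br) blast+
    show ?thesis
      using K1[OF comp(2)[OF m[unfolded gmat_brackets]]]
      by (simp add: complex_eq_iff)
  qed
  have all_full: "L = g2" if f1 f2 f3
  proof -
    have f12 f13 f23 using c_f1_f2 c_f1_f3 c_f2_f3 that by auto
    have t1: "gmat 0 0 0 0 0 0 (Complex 4 (- 2)) \<in> L"
      using br[of "gmat (Complex 1 0) 0 0 0 0 0 0" "gmat (Complex 0 1) 0 0 0 0 0 0"] \<open>f1\<close>
      by (simp add: f1_def gmat_brackets)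
    have t2: "gmat 0 0 0 0 0 0 (Complex (- 2) 4) \<in> L"
      using br[of "gmat 0 (Complex 1 0) 0 0 0 0 0" "gmat 0 (Complex 0 1) 0 0 0 0 0"] \<open>f2\<close>
      by (simp add: f2_def gmat_brackets)
    have t: "gmat 0 0 0 0 0 0 t \<in> L" for t
    proof -
      \<comment> \<open>The two brackets are independent torus directions; the coefficients solve
        the resulting 2 by 2 system.\<close>
      have "t = ((2 * Re t + Im t) / 6) *\<^sub>R Complex 4 (- 2) + ((Re t + 2 * Im t) / 6) *\<^sub>R Complex (- 2) 4"
        by (simp add: complex_eq_iff field_simps)
      then have "gmat 0 0 0 0 0 0 t = ((2 * Re t + Im t) / 6) *\<^sub>R gmat 0 0 0 0 0 0 (Complex 4 (- 2))
          + ((Re t + 2 * Im t) / 6) *\<^sub>R gmat 0 0 0 0 0 0 (Complex (- 2) 4)"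
        by (simp only: gmat_scaleR gmat_add scaleR_zero_right add_0)
      then show ?thesis using t1 t2 sub by (simp add: subspace_add subspace_scale)
    qed
    have "gmat x1 x2 x3 l12 l13 l23 t \<in> L" for x1 x2 x3 l12 l13 l23 t
    proof -
      have "gmat x1 x2 x3 l12 l13 l23 t = gmat x1 0 0 0 0 0 0 + gmat 0 x2 0 0 0 0 0 + gmat 0 0 x3 0 0 0 0
        + gmat 0 0 0 l12 0 0 0 + gmat 0 0 0 0 l13 0 0 + gmat 0 0 0 0 0 l23 0 + gmat 0 0 0 0 0 0 t"
        by (simp add: gmat_add)
      also have "\<dots> \<in> L"
        using that \<open>f12\<close> \<open>f13\<close> \<open>f23\<close> t by (auto simp: f_defs intro!: subspace_add[OF sub])
      finally show ?thesis .
    qed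
    then have "D \<in> L" if "D \<in> g2" for D
      using that by (metis g2_gmat)
    then show ?thesis using L(2) by blast
  qed
  have vanish: "(\<not> f1 \<longrightarrow> x1 = 0) \<and> (\<not> f2 \<longrightarrow> x2 = 0) \<and> (\<not> f3 \<longrightarrow> x3 = 0) \<and> (\<not> f12 \<longrightarrow> l12 = 0)
      \<and> (\<not> f13 \<longrightarrow> l13 = 0) \<and> (\<not> f23 \<longrightarrow> l23 = 0)"
    if "gmat x1 x2 x3 l12 l13 l23 t \<in> L" for x1 x2 x3 l12 l13 l23 t
    using K0[OF comp(1)[OF that]] K1[OF comp(2)[OF that]] K2[OF comp(3)[OF that]]
      K3[OF comp(4)[OF that]] K4[OF comp(5)[OF that]] K5[OF comp(6)[OF that]] by blast
  \<comment> \<open>By the closure rules the short roots present are all, none or exactly one. A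
    single one, \<open>x1\<close>, \<open>x2\<close> or \<open>x3\<close>, tolerates only its
    orthogonal long root \<open>l23\<close>, \<open>l13\<close> or \<open>l12\<close>, and then
    \<open>H_A\<close>, \<open>H45\<close> or \<open>H67\<close> is preserved.\<close>
  consider "f1 \<and> f2 \<and> f3" | "\<not> f1 \<and> \<not> f2 \<and> \<not> f3" | "\<not> f2 \<and> \<not> f3 \<and> \<not> f12 \<and> \<not> f13"
    | "\<not> f1 \<and> \<not> f3 \<and> \<not> f12 \<and> \<not> f23" | "\<not> f1 \<and> \<not> f2 \<and> \<not> f13 \<and> \<not> f23"
    using c_f1_f2 c_f1_f3 c_f2_f3 c_f1_f12 c_f1_f13 c_f2_f12 c_f2_f23 c_f3_f13 c_f3_f23 by blast
  then show ?thesis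
  proof cases
    case 1 then show ?thesis using all_full by blast
  next
    case 2
    have "D *v e 1 = 0" if D: "D \<in> L" for D
    proof -
      obtain x1 x2 x3 l12 l13 l23 t where Deq: "D = gmat x1 x2 x3 l12 l13 l23 t"
        using g2_gmat[OF subsetD[OF L(2) D]] .
      have "x1 = 0" "x2 = 0" "x3 = 0"
        using vanish[OF D[unfolded Deq]] 2 by auto
      then show ?thesis unfolding Deq by (simp add: gmat_apply vec_eq_8)
    qed
    then show ?thesis by blast
  next
    case 3
    have "D \<in> \<kk> H_A" if D: "D \<in> L" for D
    proof -
      obtain x1 x2 x3 l12 l13 l23 t where Deq: "D = gmat x1 x2 x3 l12 l13 l23 t"
        using g2_gmat[OF subsetD[OF L(2) D]] .
      have "x2 = 0" "x3 = 0" "l12 = 0" "l13 = 0"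
        using vanish[OF D[unfolded Deq]] 3 by auto
      then show ?thesis
        unfolding Deq \<kk>_def mem_Collect_eq
        by (intro conjI gmat_in_g2) (auto simp: H_A_iff gmat_def matrix_vector_8)
    qed
    then show ?thesis by blast
  next
    case 4
    have "D \<in> \<kk> H45" if D: "D \<in> L" for D
    proof -
      obtain x1 x2 x3 l12 l13 l23 t where Deq: "D = gmat x1 x2 x3 l12 l13 l23 t"
        using g2_gmat[OF subsetD[OF L(2) D]] .
      have "x1 = 0" "x3 = 0" "l12 = 0" "l23 = 0"
        using vanish[OF D[unfolded Deq]] 4 by auto
      then show ?thesis
        unfolding Deq \<kk>_def mem_Collect_eq
        by (intro conjI gmat_in_g2) (auto simp: H45_def gmat_def matrix_vector_8)
    qed
    then show ?thesis by blast
  next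
    case 5
    have "D \<in> \<kk> H67" if D: "D \<in> L" for D
    proof -
      obtain x1 x2 x3 l12 l13 l23 t where Deq: "D = gmat x1 x2 x3 l12 l13 l23 t"
        using g2_gmat[OF subsetD[OF L(2) D]] .
      have "x1 = 0" "x2 = 0" "l13 = 0" "l23 = 0"
        using vanish[OF D[unfolded Deq]] 5 by auto
      then show ?thesis
        unfolding Deq \<kk>_def mem_Collect_eq
        by (intro conjI gmat_in_g2) (auto simp: H67_def gmat_def matrix_vector_8)
    qed
    then show ?thesis by blast
  qed
qed

section \<open>Pairs conjugate under an involution\<close>

lemma lie_subalgebra_Lie: "lie_subalgebra (Lie S)"
  unfolding Lie_def by (rule hull_in) (auto simp: lie_subalgebra_def intro: subspace_Inter)

lemma Lie_superset: "S \<subseteq> Lie S"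
  unfolding Lie_def by (rule hull_subset)

lemma Lie_minimal: "S \<subseteq> L \<Longrightarrow> lie_subalgebra L \<Longrightarrow> Lie S \<subseteq> L"
  unfolding Lie_def by (rule hull_minimal)

lemma G2_mult: "g \<in> G2 \<Longrightarrow> g *v (x \<star> y) = (g *v x) \<star> (g *v y)"
  by (simp add: G2_def)

text \<open>\<open>g *v e 0\<close> is a left identity on the range of \<open>g\<close>, which
  contains \<open>e 0\<close>.\<close>

lemma G2_e0:
  assumes g: "g \<in> G2" shows "g *v e 0 = e 0"
proof -
  obtain x where x: "g *v x = e 0"
    using g by (auto simp: G2_def invertible_def) (metis matrix_vector_mul_assoc matrix_vector_mul_lid)
  have "g *v e 0 = (g *v e 0) \<star> (g *v x)" by (simp add: x)
  also have "\<dots> = g *v (e 0 \<star> x)" by (simp only: G2_mult[OF g])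
  also have "\<dots> = e 0" by (simp add: x)
  finally show ?thesis .
qed

text \<open>Taking the inverse as a separate matrix covers both \<open>matrix_inv\<close> and involutions.\<close>

lemma g2_conj:
  assumes "g \<in> G2" "g ** g' = mat 1" and Z: "Z \<in> g2"
  shows "g ** Z ** g' \<in> g2"
proof -
  have gg': "g *v (g' *v x) = x" for x
    using assms(2) by (simp add: matrix_vector_mul_assoc)
  have g'g: "g' *v (g *v x) = x" for x
    using assms(2)[unfolded matrix_left_right_inverse[of g]] by (simp add: matrix_vector_mul_assoc)
  have mult: "g' *v (x \<star> y) = (g' *v x) \<star> (g' *v y)" for x y
    using G2_mult[OF assms(1), of "g' *v x" "g' *v y"] gg' g'g by metis
  show ?thesis
    using Z by (simp add: g2_def matrix_vector_mul_assoc[symmetric] mult matrix_vector_right_distrib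
        G2_mult[OF assms(1)] gg')
qed

lemma mv_involution: "T ** T = mat 1 \<Longrightarrow> T *v (T *v x) = x" for T :: "real^'n^'n"
  by (simp add: matrix_vector_mul_assoc)

text \<open>\<open>e 0\<close> and \<open>e 1\<close> span a copy of the complex numbers, in which
  only \<open>e 1\<close> and \<open>- e 1\<close> square to \<open>- e 0\<close>; an automorphism
  preserves this equation.\<close>

lemma G2_imaginary_unit:
  assumes T: "T \<in> G2" and "(T *v e 1) $ 2 = 0" "(T *v e 1) $ 3 = 0" "(T *v e 1) $ 4 = 0" "(T *v e 1) $ 5 = 0"
    "(T *v e 1) $ 6 = 0" "(T *v e 1) $ 7 = 0"
  shows "T *v e 1 = e 1 \<or> T *v e 1 = - e 1"
proof -
  define a where "a = T *v e 1"
  have "a \<star> a = - e 0"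
    using G2_mult[OF T, of "e 1" "e 1"] by (simp add: e_mult_table mv_minus G2_e0[OF T] a_def)
  then have "(a$0)\<^sup>2 - (a$1)\<^sup>2 = - 1" "a$0 = 0 \<or> a$1 = 0"
    using assms(2-) by (auto simp: a_def[symmetric] oct_mult_coords vec_eq_8 e_nth power2_eq_square)
  moreover from this have "a$0 = 0" by (metis neg_0_equal_iff_equal diff_zero less_numeral_extra(3) neg_less_0_iff_less
        not_less not_one_less_zero power_zero_numeral zero_le_power2 zero_less_one)
  ultimately have "a$0 = 0" "a$1 = 1 \<or> a$1 = - 1" by (simp_all add: power2_eq_1_iff)
  then show ?thesis
    using assms(2-) by (auto simp: a_def[symmetric] vec_eq_8 e_nth)
qed

section \<open>Four-dimensional subalgebras invariant under \<open>Z0\<close>\<close>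

lemma dim_coordinate_subspace: "dim {x :: real^'n. \<forall>i. i \<notin> I \<longrightarrow> x $ i = 0} = card I"
proof -
  have "{x :: real^'n. \<forall>i. i \<notin> I \<longrightarrow> x $ i = 0} = {x. \<forall>b\<in>Basis. b \<notin> (\<lambda>i. axis i 1) ` I \<longrightarrow> x \<bullet> b = 0}"
    by (auto simp: Basis_vec_def inner_axis axis_eq_axis)
  moreover have "card ((\<lambda>i. axis i (1::real)) ` I) = card I"
    by (rule card_image) (simp add: inj_on_def axis_eq_axis)
  ultimately show ?thesis
    using dim_substandard[of "(\<lambda>i. axis i (1::real)) ` I :: (real^'n) set"] by (auto simp: Basis_vec_def)
qed

lemma dim_H: "dim H_A = 4" "dim H45 = 4" "dim H67 = 4"
proof -
  have eq: "H_A = {x. \<forall>i. i \<notin> {0,1,2,3} \<longrightarrow> x $ i = 0}" "H45 = {x. \<forall>i. i \<notin> {0,1,4,5} \<longrightarrow> x $ i = 0}"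
    "H67 = {x. \<forall>i. i \<notin> {0,1,6,7} \<longrightarrow> x $ i = 0}"
    by (auto simp: forall_8 H_A_iff H45_def H67_def)
  show "dim H_A = 4" "dim H45 = 4" "dim H67 = 4"
    unfolding eq dim_coordinate_subspace by simp_all
qed

lemma subspace_H: "subspace H_A" "subspace H45" "subspace H67"
  by (auto simp: subspace_def H_A_iff H45_def H67_def)

lemma Z0_apply: "Z0 *v x = vec8 0 0 (- 2 * x$3) (2 * x$2) (- (sqrt 2 - 1) * x$5) ((sqrt 2 - 1) * x$4)
    (- (sqrt 2 + 1) * x$7) ((sqrt 2 + 1) * x$6)"
  by (simp add: Z0_def \<tau>_def gmat_def matrix_vector_8 vec_eq_8)

text \<open>The square of \<open>Z0\<close> has distinct eigenvalues on the plane of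
  \<open>e 0\<close>, \<open>e 1\<close> and on the three rotated planes, so components separate as
  they do for root planes.\<close>

lemma Z0_invariant_plane_components:
  assumes W: "subspace W" "\<And>x. x \<in> W \<Longrightarrow> Z0 *v x \<in> W" and x: "x \<in> W"
  shows "x$2 *\<^sub>R e 2 + x$3 *\<^sub>R e 3 \<in> W" "x$4 *\<^sub>R e 4 + x$5 *\<^sub>R e 5 \<in> W" "x$6 *\<^sub>R e 6 + x$7 *\<^sub>R e 7 \<in> W"
proof -
  define v where "v = nth [x$0 *\<^sub>R e 0 + x$1 *\<^sub>R e 1, x$2 *\<^sub>R e 2 + x$3 *\<^sub>R e 3, x$4 *\<^sub>R e 4 + x$5 *\<^sub>R e 5,
    x$6 *\<^sub>R e 6 + x$7 *\<^sub>R e 7]"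
  define c where "c = nth [0, - 4, 2 * sqrt 2 - 3, - (3 + 2 * sqrt 2)]"
  let ?B = "\<lambda>x. Z0 *v (Z0 *v x)"
  have set4: "{..<4::nat} = {0,1,2,3}" by auto
  have lin: "linear ?B"
    by (rule linearI) (simp_all add: matrix_vector_right_distrib matrix_vector_mult_scaleR)
  have "distinct [0, - 4, 2 * sqrt 2 - 3, - (3 + 2 * sqrt 2)]"
    using sqrt2_bounds by simp
  then have inj: "inj_on c {..<4}"
    unfolding c_def by (rule inj_on_nth) auto
  have eig: "?B (v i) = c i *\<^sub>R v i" if "i \<in> {..<4}" for i
    using that unfolding set4 by (auto simp: v_def c_def Z0_apply vec_eq_8 e_nth algebra_simps)
  have sum: "sum v {..<4} \<in> W"
  proof -
    have "sum v {..<4} = x" unfolding set4 by (simp add: v_def vec_eq_8 e_nth)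
    then show ?thesis using x by simp
  qed
  have all: "v i \<in> W" if "i \<in> {..<4}" for i
    by (rule eigencomponents_in_invariant_subspace[OF lin W(1) _ _ inj eig sum that]) (use W(2) in auto)
  show "x$2 *\<^sub>R e 2 + x$3 *\<^sub>R e 3 \<in> W" "x$4 *\<^sub>R e 4 + x$5 *\<^sub>R e 5 \<in> W" "x$6 *\<^sub>R e 6 + x$7 *\<^sub>R e 7 \<in> W"
    using all[of 1] all[of 2] all[of 3] by (simp_all add: v_def)
qed

text \<open>\<open>u\<close> and \<open>v\<close> are recovered from a vector and its quarter turn
  by Cramer's rule, with determinant \<open>p * p + q * q\<close>.\<close>

lemma full_rotation_plane:
  fixes u v :: "'a::real_vector"
  assumes "subspace W" "p *\<^sub>R u + q *\<^sub>R v \<in> W" "w *\<^sub>R (p *\<^sub>R v - q *\<^sub>R u) \<in> W" "w \<noteq> 0" "p \<noteq> 0 \<or> q \<noteq> 0"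
  shows "u \<in> W" "v \<in> W"
proof -
  have 1: "p *\<^sub>R v - q *\<^sub>R u \<in> W"
    using subspace_scale[OF assms(1,3), of "1 / w"] assms(4) by simp
  define n where "n = p * p + q * q"
  have "n \<noteq> 0" using assms(5) by (simp add: n_def sum_squares_eq_zero_iff)
  then have div: "x \<in> W" if "n *\<^sub>R x \<in> W" for x
    using subspace_scale[OF assms(1) that, of "1 / n"] by simp
  have "p *\<^sub>R (p *\<^sub>R u + q *\<^sub>R v) - q *\<^sub>R (p *\<^sub>R v - q *\<^sub>R u) \<in> W"
    by (intro subspace_diff subspace_scale assms 1)
  then show "u \<in> W" using div[of u] by (simp add: n_def algebra_simps)
  have "q *\<^sub>R (p *\<^sub>R u + q *\<^sub>R v) + p *\<^sub>R (p *\<^sub>R v - q *\<^sub>R u) \<in> W"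
    by (intro subspace_add subspace_scale assms 1)
  then show "v \<in> W" using div[of v] by (simp add: n_def algebra_simps)
qed

lemma subset_of_coordinates:
  assumes W: "subspace W" "e 0 \<in> W" "e 1 \<in> W"
  shows "e 2 \<in> W \<Longrightarrow> e 3 \<in> W \<Longrightarrow> H_A \<subseteq> W" "e 4 \<in> W \<Longrightarrow> e 5 \<in> W \<Longrightarrow> H45 \<subseteq> W"
    "e 6 \<in> W \<Longrightarrow> e 7 \<in> W \<Longrightarrow> H67 \<subseteq> W"
proof -
  have comb: "a *\<^sub>R e 0 + b *\<^sub>R e 1 + c *\<^sub>R e i + d *\<^sub>R e j \<in> W" if "e i \<in> W" "e j \<in> W" for a b c d i j
    using W that by (intro subspace_add subspace_scale)
  have A: "x = x$0 *\<^sub>R e 0 + x$1 *\<^sub>R e 1 + x$2 *\<^sub>R e 2 + x$3 *\<^sub>R e 3" if "x \<in> H_A" for x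
    using that by (simp add: H_A_iff vec_eq_8 e_nth)
  show "e 2 \<in> W \<Longrightarrow> e 3 \<in> W \<Longrightarrow> H_A \<subseteq> W" using A comb[of 2 3] by (metis subsetI)
  have A: "x = x$0 *\<^sub>R e 0 + x$1 *\<^sub>R e 1 + x$4 *\<^sub>R e 4 + x$5 *\<^sub>R e 5" if "x \<in> H45" for x
    using that by (simp add: H45_def vec_eq_8 e_nth)
  show "e 4 \<in> W \<Longrightarrow> e 5 \<in> W \<Longrightarrow> H45 \<subseteq> W" using A comb[of 4 5] by (metis subsetI)
  have A: "x = x$0 *\<^sub>R e 0 + x$1 *\<^sub>R e 1 + x$6 *\<^sub>R e 6 + x$7 *\<^sub>R e 7" if "x \<in> H67" for x
    using that by (simp add: H67_def vec_eq_8 e_nth)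
  show "e 6 \<in> W \<Longrightarrow> e 7 \<in> W \<Longrightarrow> H67 \<subseteq> W" using A comb[of 6 7] by (metis subsetI)
qed

text \<open>A nonzero component in a rotated plane puts that whole plane into \<open>W\<close>. The
  product of its two basis vectors is \<open>e 1\<close> up to sign, and together with
  \<open>e 0\<close> this fills dimension four.\<close>

lemma Z0_invariant_subalgebra:
  assumes W: "subspace W" "\<And>x y. x \<in> W \<Longrightarrow> y \<in> W \<Longrightarrow> x \<star> y \<in> W" "e 0 \<in> W" "dim W = 4"
    and Z0: "\<And>x. x \<in> W \<Longrightarrow> Z0 *v x \<in> W"
  shows "W = H_A \<or> W = H45 \<or> W = H67"
proof -
  have eqI: "W = H" if "H \<subseteq> W" "dim H = 4" "subspace H" for H
    using subspace_dim_equal[OF that(3) W(1) that(1)] W(4) that(2) by simp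
  have s: "sqrt 2 - 1 \<noteq> 0" "sqrt 2 + 1 \<noteq> 0" using sqrt2_bounds by auto
  consider (A) x where "x \<in> W" "x$2 \<noteq> 0 \<or> x$3 \<noteq> 0" | (B) x where "x \<in> W" "x$4 \<noteq> 0 \<or> x$5 \<noteq> 0"
    | (C) x where "x \<in> W" "x$6 \<noteq> 0 \<or> x$7 \<noteq> 0"
    | (D) "\<forall>x\<in>W. x$2 = 0 \<and> x$3 = 0 \<and> x$4 = 0 \<and> x$5 = 0 \<and> x$6 = 0 \<and> x$7 = 0"
    by blast
  then show ?thesis
  proof cases
    case A
    note c = Z0_invariant_plane_components(1)[OF W(1) Z0 A(1)]
    have "Z0 *v (x$2 *\<^sub>R e 2 + x$3 *\<^sub>R e 3) = 2 *\<^sub>R (x$2 *\<^sub>R e 3 - x$3 *\<^sub>R e 2)"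
      by (simp add: Z0_apply vec_eq_8 e_nth)
    then have "e 2 \<in> W" "e 3 \<in> W"
      using full_rotation_plane[OF W(1) c, of "2"] Z0[OF c] A(2) s by auto
    moreover have "e 1 \<in> W"
      using W(2)[OF calculation] by (simp add: e_mult_table)
    ultimately show ?thesis
      using eqI[OF _ dim_H(1) subspace_H(1)] subset_of_coordinates(1)[OF W(1,3)] by blast
  next
    case B
    note c = Z0_invariant_plane_components(2)[OF W(1) Z0 B(1)]
    have "Z0 *v (x$4 *\<^sub>R e 4 + x$5 *\<^sub>R e 5) = (sqrt 2 - 1) *\<^sub>R (x$4 *\<^sub>R e 5 - x$5 *\<^sub>R e 4)"
      by (simp add: Z0_apply vec_eq_8 e_nth algebra_simps)
    then have "e 4 \<in> W" "e 5 \<in> W"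
      using full_rotation_plane[OF W(1) c, of "(sqrt 2 - 1)"] Z0[OF c] B(2) s by auto
    moreover have "e 1 \<in> W"
      using W(2)[OF calculation] by (simp add: e_mult_table)
    ultimately show ?thesis
      using eqI[OF _ dim_H(2) subspace_H(2)] subset_of_coordinates(2)[OF W(1,3)] by blast
  next
    case C
    note c = Z0_invariant_plane_components(3)[OF W(1) Z0 C(1)]
    have "Z0 *v (x$6 *\<^sub>R e 6 + x$7 *\<^sub>R e 7) = (sqrt 2 + 1) *\<^sub>R (x$6 *\<^sub>R e 7 - x$7 *\<^sub>R e 6)"
      by (simp add: Z0_apply vec_eq_8 e_nth algebra_simps)
    then have "e 6 \<in> W" "e 7 \<in> W"
      using full_rotation_plane[OF W(1) c, of "(sqrt 2 + 1)"] Z0[OF c] C(2) s by auto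
    moreover have "e 1 \<in> W"
      using subspace_neg[OF W(1) W(2)[OF calculation]] by (simp add: e_mult_table)
    ultimately show ?thesis
      using eqI[OF _ dim_H(3) subspace_H(3)] subset_of_coordinates(3)[OF W(1,3)] by blast
  next
    \<comment> \<open>Without such a component \<open>W\<close> would have dimension at most
      two.\<close>
    case D
    have "W \<subseteq> {x. \<forall>i. i \<notin> {0,1} \<longrightarrow> x $ i = 0}" using D by (auto simp: forall_8)
    from dim_subset[OF this] show ?thesis unfolding dim_coordinate_subspace using W(4) by simp
  qed
qed

lemma involution_image_twice:
  fixes T :: "real^'n^'n"
  assumes "T ** T = mat 1" "(*v) T ` H = K" shows "(*v) T ` K = H"
  using assms by (auto simp: mv_involution image_image)

text \<open>\<open>T\<close> intertwines the action of \<open>T ** Z ** T\<close> on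
  \<open>H\<close> with that of \<open>Z\<close> on the image of \<open>H\<close>.\<close>

lemma conj_preserves_imp_preserves_image:
  assumes TT: "T ** T = mat 1" and Z: "T ** Z ** T \<in> \<kk> H" and x: "x \<in> (*v) T ` H"
  shows "Z *v x \<in> (*v) T ` H"
proof -
  obtain h where h: "h \<in> H" "x = T *v h" using x by auto
  have "(T ** Z ** T) *v h \<in> H" using Z h by (simp add: \<kk>_def)
  then have "T *v (Z *v x) \<in> H" by (simp add: h matrix_vector_mul_assoc matrix_mul_assoc)
  then have "T *v (T *v (Z *v x)) \<in> (*v) T ` H" by blast
  then show ?thesis by (simp add: mv_involution[OF TT])
qed

text \<open>A proper generated algebra would fall under an exceptional case of
  \<open>subalgebra_containing_Z0\<close>; applying \<open>T\<close> to the object preserved there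
  makes it \<open>T\<close>-invariant or forces \<open>T *v e 1\<close> into the plane of
  \<open>e 0\<close> and \<open>e 1\<close>.\<close>

lemma Lie_Z0_involution:
  assumes T: "T \<in> G2" "T ** T = mat 1" and e1: "T *v e 1 \<noteq> e 1" "T *v e 1 \<noteq> - e 1"
    and H: "(*v) T ` H_A \<noteq> H_A" "(*v) T ` H45 \<noteq> H45" "(*v) T ` H67 \<noteq> H67"
  shows "Lie {Z0, T ** Z0 ** T} = g2"
proof (rule ccontr)
  let ?L = "Lie {Z0, T ** Z0 ** T}"
  assume ne: "?L \<noteq> g2"
  have Z0: "Z0 \<in> g2" unfolding Z0_def by (rule gmat_in_g2)
  have sub: "?L \<subseteq> g2"
    using Z0 g2_conj[OF T Z0] by (intro Lie_minimal lie_subalgebra_g2) auto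
  have mem: "Z0 \<in> ?L" "T ** Z0 ** T \<in> ?L" using Lie_superset by blast+
  have not_line: "\<not> ((T *v e 1) $ 2 = 0 \<and> (T *v e 1) $ 3 = 0 \<and> (T *v e 1) $ 4 = 0 \<and> (T *v e 1) $ 5 = 0
      \<and> (T *v e 1) $ 6 = 0 \<and> (T *v e 1) $ 7 = 0)"
    using G2_imaginary_unit[OF T(1)] e1 by blast
  have closed: "x \<star> y \<in> H" if "H \<in> {H_A, H45, H67}" "x \<in> H" "y \<in> H" for x y H
    using that by (auto simp: H_A_iff H45_def H67_def oct_mult_coords)
  have e01: "e 0 \<in> H" "e 1 \<in> H" if "H \<in> {H_A, H45, H67}" for H
    using that by (auto simp: H_A_iff H45_def H67_def e_nth)
  have inj: "inj ((*v) T)" by (rule injI) (metis mv_involution[OF T(2)])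
  \<comment> \<open>The image of \<open>H\<close> under \<open>T\<close> is one of the three
    algebras but not \<open>H\<close>. As \<open>T\<close> swaps the two, both contain
    \<open>T *v e 1\<close>, and they meet only in the plane of \<open>e 0\<close> and
    \<open>e 1\<close>.\<close>
  have no_plane: False if Hm: "H \<in> {H_A, H45, H67}" and LH: "?L \<subseteq> \<kk> H" for H
  proof -
    have sH: "subspace H" "dim H = 4" using Hm subspace_H dim_H by auto
    have "T ** Z0 ** T \<in> \<kk> H" using LH mem by blast
    note inv = conj_preserves_imp_preserves_image[OF T(2) this]
    have K: "(*v) T ` H \<in> {H_A, H45, H67}"
    proof -
      have "subspace ((*v) T ` H)" using sH by (intro linear_subspace_image) auto
      moreover have "x \<star> y \<in> (*v) T ` H" if "x \<in> (*v) T ` H" "y \<in> (*v) T ` H" for x y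
        using that closed[OF Hm] by (auto simp: G2_mult[OF T(1), symmetric])
      moreover have "e 0 \<in> (*v) T ` H" using G2_e0[OF T(1)] e01[OF Hm] by (metis image_eqI)
      moreover have "dim ((*v) T ` H) = 4"
        using dim_image_eq[of "(*v) T" H] inj sH by (auto intro: inj_on_subset)
      ultimately show ?thesis using Z0_invariant_subalgebra inv by blast
    qed
    have "T *v e 1 \<in> (*v) T ` H" using e01[OF Hm] by blast
    moreover have "T *v e 1 \<in> H"
      using involution_image_twice[OF T(2) refl, of H] e01[OF K] by blast
    moreover have "(*v) T ` H \<noteq> H" using Hm H by auto
    ultimately show False
      using Hm K not_line by (auto simp: H_A_iff H45_def H67_def)
  qed
  \<comment> \<open>If \<open>?L\<close> killed \<open>e 1\<close>, then \<open>Z0\<close> would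
    kill \<open>T *v e 1\<close>, but the kernel of \<open>Z0\<close> is the plane of
    \<open>e 0\<close> and \<open>e 1\<close>.\<close>
  have "\<not> (\<forall>D\<in>?L. D *v e 1 = 0)"
  proof
    assume "\<forall>D\<in>?L. D *v e 1 = 0"
    then have "(T ** Z0 ** T) *v e 1 = 0" using mem by blast
    then have "T *v (Z0 *v (T *v e 1)) = 0" by (simp add: matrix_vector_mul_assoc matrix_mul_assoc)
    then have "Z0 *v (T *v e 1) = 0" by (metis mv_involution[OF T(2)] matrix_vector_mult_0_right)
    then show False using not_line sqrt2_bounds by (simp add: Z0_apply vec_eq_8)
  qed
  then show False
    using subalgebra_containing_Z0[OF lie_subalgebra_Lie sub mem(1)] ne no_plane by blast
qed

section \<open>Conjugation and normal forms\<close>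

lemma mat_inverse_cancel:
  fixes g :: "real^'n^'n"
  assumes "g ** g' = mat 1"
  shows "g' ** g = mat 1" "g *v (g' *v x) = x" "g' *v (g *v x) = x" "X ** g ** g' = X" "X ** g' ** g = X"
    "g ** (g' ** X) = X" "g' ** (g ** X) = X"
proof -
  show 1: "g' ** g = mat 1" using assms by (simp only: matrix_left_right_inverse)
  show "g *v (g' *v x) = x" "g' *v (g *v x) = x" using assms 1 by (simp_all add: matrix_vector_mul_assoc)
  show "X ** g ** g' = X" "X ** g' ** g = X" using assms 1 by (simp_all add: matrix_mul_assoc[symmetric])
  show "g ** (g' ** X) = X" "g' ** (g ** X) = X" using assms 1 by (simp_all add: matrix_mul_assoc)
qed

lemma linear_conj: "linear (\<lambda>X. g ** X ** g')" for g g' :: "real^'n^'n"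
  by (rule linearI) (simp_all add: vec_eq_iff matrix_matrix_mult_def sum.distrib sum_distrib_left sum_distrib_right
      algebra_simps)

lemma lie_bracket_conj:
  assumes "g ** g' = mat 1"
  shows "lie_bracket (g ** X ** g') (g ** Y ** g') = g ** lie_bracket X Y ** g'"
proof -
  have "g ** X ** g' ** (g ** Y ** g') = g ** (X ** Y) ** g'" for X Y
    by (simp add: matrix_mul_assoc mat_inverse_cancel[OF assms])
  then show ?thesis
    using linear_diff[OF linear_conj[of g g']] by (simp add: lie_bracket_def)
qed

lemma Lie_conj_subset:
  assumes "g ** g' = mat 1"
  shows "Lie ((\<lambda>X. g ** X ** g') ` S) \<subseteq> (\<lambda>X. g ** X ** g') ` Lie S"
proof (rule Lie_minimal)
  show "(\<lambda>X. g ** X ** g') ` S \<subseteq> (\<lambda>X. g ** X ** g') ` Lie S"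
    using Lie_superset by blast
  show "lie_subalgebra ((\<lambda>X. g ** X ** g') ` Lie S)"
    using lie_subalgebra_Lie[of S] linear_subspace_image[OF linear_conj[of g g']]
    by (auto simp: lie_subalgebra_def lie_bracket_conj[OF assms])
qed

lemma G2_inverse:
  assumes "g \<in> G2" "g ** g' = mat 1" shows "g' \<in> G2"
proof -
  have "g' *v (x \<star> y) = (g' *v x) \<star> (g' *v y)" for x y
    using G2_mult[OF assms(1), of "g' *v x" "g' *v y"] mat_inverse_cancel(2,3)[OF assms(2)] by metis
  then show ?thesis
    using assms(2) mat_inverse_cancel(1)[OF assms(2)] by (auto simp: G2_def invertible_def)
qed

lemma G2_compose: "g \<in> G2 \<Longrightarrow> h \<in> G2 \<Longrightarrow> g ** h \<in> G2"
  by (simp add: G2_def invertible_mult matrix_vector_mul_assoc[symmetric])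

lemma Lie_conj_eq_g2:
  assumes g: "g \<in> G2" "g ** g' = mat 1"
  shows "Lie {g ** X ** g', g ** Y ** g'} = g2 \<longleftrightarrow> Lie {X, Y} = g2"
proof -
  \<comment> \<open>One implication, stated for all pairs so that it serves for \<open>g\<close> and
    again for its inverse.\<close>
  have gen: "Lie {h ** X ** h', h ** Y ** h'} = g2" if h: "h \<in> G2" "h ** h' = mat 1" and L: "Lie {X, Y} = g2" for h h' X Y
  proof -
    note hh = mat_inverse_cancel[OF h(2)]
    have "X \<in> g2" "Y \<in> g2" using L Lie_superset[of "{X, Y}"] by auto
    then have up: "Lie {h ** X ** h', h ** Y ** h'} \<subseteq> g2"
      using g2_conj[OF h] by (intro Lie_minimal lie_subalgebra_g2) auto
    have "Z \<in> Lie {h ** X ** h', h ** Y ** h'}" if "Z \<in> g2" for Z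
    proof -
      have "h' ** Z ** h \<in> Lie {X, Y}" using g2_conj[OF G2_inverse[OF h] hh(1) that] L by simp
      also have "{X, Y} = (\<lambda>X. h' ** X ** h) ` {h ** X ** h', h ** Y ** h'}"
        by (simp add: matrix_mul_assoc hh)
      finally obtain W where W: "W \<in> Lie {h ** X ** h', h ** Y ** h'}" "h' ** Z ** h = h' ** W ** h"
        using Lie_conj_subset[OF hh(1)] by blast
      have "h ** (h' ** Z ** h) ** h' = h ** (h' ** W ** h) ** h'" using W(2) by simp
      then have "Z = W" by (simp add: matrix_mul_assoc hh h(2))
      then show ?thesis using W(1) by simp
    qed
    then show ?thesis using up by blast
  qed
  note gg = mat_inverse_cancel[OF g(2)]
  have *: "g' ** (g ** X ** g') ** g = X" for X
    by (simp add: matrix_mul_assoc gg)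
  show ?thesis
    using gen[OF g, of X Y] gen[OF G2_inverse[OF g] gg(1), of "g ** X ** g'" "g ** Y ** g'"] unfolding * by blast
qed

lemma Lie_scaleR:
  assumes "c \<noteq> 0" shows "Lie {c *\<^sub>R X, c *\<^sub>R Y} = Lie {X, Y}"
proof -
  have gen: "Lie {c *\<^sub>R X, c *\<^sub>R Y} \<subseteq> Lie {X, Y}" for c X Y
    using lie_subalgebra_Lie[of "{X, Y}"] Lie_superset[of "{X, Y}"]
    by (intro Lie_minimal lie_subalgebra_Lie) (auto simp: lie_subalgebra_def subspace_scale)
  show ?thesis
    using gen[of c X Y] gen[of "1 / c" "c *\<^sub>R X" "c *\<^sub>R Y"] assms by auto
qed

section \<open>Normal forms of the derivations \<open>Z_der a b\<close>\<close>

lemma matrix_matrix_8: "((A :: real^8^8) ** B) $ i $ j = A$i$0*B$0$j + A$i$1*B$1$j + A$i$2*B$2$j + A$i$3*B$3$j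
    + A$i$4*B$4$j + A$i$5*B$5$j + A$i$6*B$6$j + A$i$7*B$7$j"
  by (simp add: matrix_matrix_mult_def sum_8)

text \<open>The coordinates along \<open>e 1\<close> go to the torus, the others to the orthogonal
  root planes with coordinates \<open>x1\<close> and \<open>l23\<close>.\<close>

lemma Z_der_gmat:
  "Z_der (a1 *\<^sub>R e 1 + a2 *\<^sub>R e 2 + a3 *\<^sub>R e 3) (b1 *\<^sub>R e 1 + b2 *\<^sub>R e 2 + b3 *\<^sub>R e 3)
    = gmat (Complex a3 (- a2)) 0 0 0 0 (Complex b3 (- b2)) (Complex (2 * a1) (b1 - a1))" (is "?Z = ?G")
proof -
  have "?Z *v v = ?G *v v" for v
  proof -
    have "v = part1 v + part2 v \<star> e 4"
      by (simp add: part1_def part2_def oct_mult_coords vec_eq_8 e_nth)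
    moreover have "part1 v \<in> H_A" "part2 v \<in> H_A"
      by (simp_all add: part1_def part2_def H_A_iff e_nth)
    ultimately have "?Z *v v = ((a1 *\<^sub>R e 1 + a2 *\<^sub>R e 2 + a3 *\<^sub>R e 3) \<star> part1 v
        - part1 v \<star> (a1 *\<^sub>R e 1 + a2 *\<^sub>R e 2 + a3 *\<^sub>R e 3))
       + ((b1 *\<^sub>R e 1 + b2 *\<^sub>R e 2 + b3 *\<^sub>R e 3) \<star> part2 v
        - part2 v \<star> (a1 *\<^sub>R e 1 + a2 *\<^sub>R e 2 + a3 *\<^sub>R e 3)) \<star> e 4"
      using Z_der_apply by metis
    also have "\<dots> = ?G *v v"
      by (simp add: oct_mult_coords vec_eq_8 part1_def part2_def e_nth gmat_def matrix_vector_8 algebra_simps)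
    finally show ?thesis .
  qed
  then show ?thesis by (simp add: matrix_eq)
qed

text \<open>The automorphism fixing \<open>H_A\<close> pointwise and sending \<open>y \<star> e 4\<close> to \<open>(q \<star> y) \<star> e 4\<close>.\<close>

definition left_rotation :: "real \<Rightarrow> real \<Rightarrow> real \<Rightarrow> real \<Rightarrow> endo"
  where "left_rotation q0 q1 q2 q3 = vec8
     (vec8 1 0 0 0 0 0 0 0)
     (vec8 0 1 0 0 0 0 0 0)
     (vec8 0 0 1 0 0 0 0 0)
     (vec8 0 0 0 1 0 0 0 0)
     (vec8 0 0 0 0 q0 (- q1) (- q2) (- q3))
     (vec8 0 0 0 0 q1 q0 (- q3) q2)
     (vec8 0 0 0 0 q2 q3 q0 (- q1))
     (vec8 0 0 0 0 q3 (- q2) q1 q0)"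

lemma mat1_nth: "mat 1 $ i $ j = (if i = j then 1 else 0)"
  by (simp add: mat_def)

lemma left_rotation_inverse:
  assumes "q0\<^sup>2 + q1\<^sup>2 + q2\<^sup>2 + q3\<^sup>2 = 1"
  shows "left_rotation q0 q1 q2 q3 ** left_rotation q0 (- q1) (- q2) (- q3) = mat 1"
  using assms by (simp add: vec_eq_8 matrix_matrix_8 mat1_nth left_rotation_def power2_eq_square)

lemma left_rotation_G2:
  assumes q: "q0\<^sup>2 + q1\<^sup>2 + q2\<^sup>2 + q3\<^sup>2 = 1"
  shows "left_rotation q0 q1 q2 q3 \<in> G2"
proof -
  let ?g = "left_rotation q0 q1 q2 q3"
  let ?n = "1 - (q0\<^sup>2 + q1\<^sup>2 + q2\<^sup>2 + q3\<^sup>2)"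
  have "?g *v (x \<star> y) = (?g *v x) \<star> (?g *v y)" for x y
  proof -
    \<comment> \<open>The defect of multiplicativity is a multiple of \<open>?n\<close>, which
      vanishes for a unit quaternion.\<close>
    have "?g *v (x \<star> y) - (?g *v x) \<star> (?g *v y) = ?n *\<^sub>R vec8
       (- (x$4*y$4 + x$5*y$5 + x$6*y$6 + x$7*y$7)) (x$4*y$5 - x$5*y$4 - x$6*y$7 + x$7*y$6)
       (x$4*y$6 + x$5*y$7 - x$6*y$4 - x$7*y$5) (x$4*y$7 - x$5*y$6 + x$6*y$5 - x$7*y$4) 0 0 0 0"
      by (simp add: vec_eq_8 matrix_vector_8 left_rotation_def oct_mult_coords power2_eq_square algebra_simps)
    then show ?thesis using q by simp
  qed
  moreover have "invertible ?g"
    using left_rotation_inverse[OF q] mat_inverse_cancel(1)[OF left_rotation_inverse[OF q]]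
    by (auto simp: invertible_def)
  ultimately show ?thesis by (simp add: G2_def)
qed

text \<open>Given by rows: it permutes \<open>e 1\<close>, \<open>e 2\<close>, \<open>e 3\<close>
  and \<open>e 5\<close>, \<open>e 6\<close>, \<open>e 7\<close> cyclically, with \<open>e 1\<close>
  going to \<open>e 2\<close>, and so carries the case \<open>a = e 1\<close> to the case
  \<open>a = e 2\<close>.\<close>

definition cyc :: endo
  where "cyc = vec8 (e 0) (e 3) (e 1) (e 2) (e 4) (e 7) (e 5) (e 6)"

lemma cyc_G2: "cyc \<in> G2" and cyc_inverse: "cyc ** (cyc ** cyc) = mat 1"
proof -
  show 1: "cyc ** (cyc ** cyc) = mat 1"
    by (simp add: vec_eq_8 matrix_matrix_8 mat1_nth cyc_def e_nth)
  have "invertible cyc"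
    unfolding invertible_def using 1 mat_inverse_cancel(1)[OF 1] by blast
  then show "cyc \<in> G2"
    by (simp add: G2_def vec_eq_8 matrix_vector_8 cyc_def e_nth oct_mult_coords)
qed

text \<open>The subalgebras preserved by \<open>Z_der (e 1) b\<close> other than \<open>H_A\<close> are \<open>twisted b (sqrt 2)\<close> and
  \<open>twisted b (- sqrt 2)\<close>.\<close>

definition twisted :: "real^8 \<Rightarrow> real \<Rightarrow> (real^8) set"
  where "twisted b \<sigma> = {x. x$2 = 0 \<and> x$3 = 0 \<and> b \<star> part2 x = \<sigma> *\<^sub>R (part2 x \<star> e 1)}"

text \<open>The half turn about the sum of \<open>b\<close> and \<open>sqrt 2 *\<^sub>R e 1\<close>
  exchanges these two vectors of equal length, so left multiplication by the unit quaternion along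
  the sum conjugates \<open>Z0\<close> to \<open>Z_der (e 1) b\<close>. The bound on
  \<open>b1\<close> keeps the sum from vanishing.\<close>

lemma Z_der_frame:
  assumes b: "b = b1 *\<^sub>R e 1 + b2 *\<^sub>R e 2 + b3 *\<^sub>R e 3" "b1\<^sup>2 + b2\<^sup>2 + b3\<^sup>2 = 2" "- sqrt 2 < b1"
  obtains g g' where "g \<in> G2" "g ** g' = mat 1" "Z_der (e 1) b = g ** Z0 ** g'" "g *v e 1 = e 1"
    "(*v) g ` H_A = H_A" "(*v) g ` H45 \<subseteq> twisted b (sqrt 2)" "(*v) g ` H67 \<subseteq> twisted b (- sqrt 2)"
proof -
  define s where "s = sqrt 2"
  have s: "s * s = 2" "0 < s" by (simp_all add: s_def)
  \<comment> \<open>Normalises the sum of \<open>b\<close> and \<open>s *\<^sub>R e 1\<close>, whose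
    squared length is \<open>4 + 2 * s * b1\<close>.\<close>
  define r where "r = 1 / sqrt (4 + 2 * s * b1)"
  have "0 < s * (s + b1)" using s b(3) by (intro mult_pos_pos) (auto simp: s_def)
  then have "0 < 4 + 2 * s * b1" using s by (simp add: algebra_simps)
  then have r: "r\<^sup>2 * (4 + 2 * s * b1) = 1" by (simp add: r_def power_divide)
  define q1 where "q1 = r * (b1 + s)"
  define q2 where "q2 = r * b2"
  define q3 where "q3 = r * b3"
  have "q1\<^sup>2 + q2\<^sup>2 + q3\<^sup>2 = r\<^sup>2 * ((b1\<^sup>2 + b2\<^sup>2 + b3\<^sup>2) + s * s + 2 * s * b1)"
    by (simp add: q1_def q2_def q3_def power2_eq_square algebra_simps)
  also have "\<dots> = 1" using b(2) s r by (simp add: algebra_simps)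
  finally have n: "0\<^sup>2 + q1\<^sup>2 + q2\<^sup>2 + q3\<^sup>2 = 1" by simp
  \<comment> \<open>For \<open>q\<close> with coordinates \<open>q1\<close>, \<open>q2\<close>,
    \<open>q3\<close>, the facts \<open>R1\<close> and \<open>R\<close> are the coordinates of
    \<open>b \<star> q = s *\<^sub>R (q \<star> e 1)\<close>.\<close>
  have "b1 * q1 + b2 * q2 + b3 * q3 = r * ((b1\<^sup>2 + b2\<^sup>2 + b3\<^sup>2) + s * b1)"
    by (simp add: q1_def q2_def q3_def power2_eq_square algebra_simps)
  also have "\<dots> = r * (s * s + s * b1)" using b(2) s by simp
  finally have R1: "b1 * q1 = s * q1 - b2 * q2 - b3 * q3"
    by (simp add: q1_def algebra_simps)
  have R: "b2 * q3 = b3 * q2" "b3 * q1 = b1 * q3 + s * q3" "b1 * q2 = b2 * q1 - s * q2"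
    by (simp_all add: q1_def q2_def q3_def algebra_simps)
  let ?g = "left_rotation 0 q1 q2 q3" and ?g' = "left_rotation 0 (- q1) (- q2) (- q3)"
  have gg: "?g ** ?g' = mat 1" using left_rotation_inverse[OF n] by simp
  have "Z_der (e 1) b = gmat 0 0 0 0 0 (Complex b3 (- b2)) (Complex 2 (b1 - 1))"
    using Z_der_gmat[of 1 0 0 b1 b2 b3] by (simp add: b(1) zero_complex.ctr)
  moreover have "gmat 0 0 0 0 0 (Complex b3 (- b2)) (Complex 2 (b1 - 1)) ** ?g = ?g ** Z0"
    using R R1 by (simp add: vec_eq_8 matrix_matrix_8 gmat_def Z0_def \<tau>_def left_rotation_def s_def[symmetric] algebra_simps)
  ultimately have 3: "Z_der (e 1) b = ?g ** Z0 ** ?g'"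
    using mat_inverse_cancel(4)[OF gg] by metis
  have 5: "(*v) ?g ` H_A = H_A"
  proof -
    have "?g *v x = x" if "x \<in> H_A" for x
      using that by (simp add: H_A_iff vec_eq_8 matrix_vector_8 left_rotation_def)
    then show ?thesis by (simp add: image_def)
  qed
  have R': "b1 * q1 * z = s * q1 * z - b2 * q2 * z - b3 * q3 * z" "b2 * q3 * z = b3 * q2 * z"
    "b3 * q1 * z = b1 * q3 * z + s * q3 * z" "b1 * q2 * z = b2 * q1 * z - s * q2 * z" for z
    using arg_cong[OF R1, of "\<lambda>t. t * z"] arg_cong[OF R(1), of "\<lambda>t. t * z"] arg_cong[OF R(2), of "\<lambda>t. t * z"]
      arg_cong[OF R(3), of "\<lambda>t. t * z"]
    by (simp_all only: left_diff_distrib distrib_right)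
  have R2: "b2 * (q3 * z) = b3 * (q2 * z)" for z using R'(2)[of z] by (simp only: mult.assoc)
  \<comment> \<open>\<open>part2\<close> of a vector of \<open>H45\<close> commutes with
    \<open>e 1\<close>, that of a vector of \<open>H67\<close> anticommutes; hence the opposite
    signs.\<close>
  have "?g *v x \<in> twisted b (sqrt 2)" if "x \<in> H45" for x
    using that R'(1,3,4)[of "x $ 4"] R'(1,3,4)[of "x $ 5"]
    by (auto simp: H45_def twisted_def matrix_vector_8 left_rotation_def part2_def oct_mult_coords vec_eq_8 e_nth
       b(1) s_def[symmetric] algebra_simps R2)
  then have 6: "(*v) ?g ` H45 \<subseteq> twisted b (sqrt 2)" by blast
  have "?g *v x \<in> twisted b (- sqrt 2)" if "x \<in> H67" for x
    using that R'(1,3,4)[of "x $ 6"] R'(1,3,4)[of "x $ 7"]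
    by (auto simp: H67_def twisted_def matrix_vector_8 left_rotation_def part2_def oct_mult_coords vec_eq_8 e_nth
       b(1) s_def[symmetric] algebra_simps R2)
  then have 7: "(*v) ?g ` H67 \<subseteq> twisted b (- sqrt 2)" by blast
  have 4: "?g *v e 1 = e 1"
    by (simp add: vec_eq_8 matrix_vector_8 left_rotation_def e_nth)
  show ?thesis
    using that[OF left_rotation_G2[OF n] gg 3 4 5 6 7] .
qed

text \<open>Moves a conjugation from \<open>Z\<close> to \<open>T\<close>, so that questions about a
  conjugate of \<open>Z\<close> become questions about \<open>Z\<close> and another involutive
  automorphism.\<close>

lemma conj_involution:
  assumes T: "T \<in> G2" "T ** T = mat 1" and g: "g \<in> G2" "g ** g' = mat 1"
  shows "g' ** T ** g \<in> G2" "(g' ** T ** g) ** (g' ** T ** g) = mat 1"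
    "T ** (g ** Z ** g') ** T = g ** ((g' ** T ** g) ** Z ** (g' ** T ** g)) ** g'"
proof -
  note gg = mat_inverse_cancel[OF g(2)]
  show "g' ** T ** g \<in> G2"
    by (intro G2_compose T g G2_inverse[OF g])
  have "(g' ** T ** g) ** (g' ** T ** g) = g' ** (T ** (g ** g') ** T) ** g"
    by (simp only: matrix_mul_assoc)
  then show "(g' ** T ** g) ** (g' ** T ** g) = mat 1"
    by (simp add: g(2) T(2) gg(1))
  have "g ** ((g' ** T ** g) ** Z ** (g' ** T ** g)) ** g' = (g ** g') ** T ** (g ** Z ** g') ** T ** (g ** g')"
    by (simp only: matrix_mul_assoc)
  then show "T ** (g ** Z ** g') ** T = g ** ((g' ** T ** g) ** Z ** (g' ** T ** g)) ** g'"
    by (simp add: g(2))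
qed

lemma Lie_pair_conj:
  assumes "T \<in> G2" "T ** T = mat 1" "g \<in> G2" "g ** g' = mat 1"
  shows "Lie {g ** Z ** g', T ** (g ** Z ** g') ** T} = g2 \<longleftrightarrow> Lie {Z, (g' ** T ** g) ** Z ** (g' ** T ** g)} = g2"
  unfolding conj_involution(3)[OF assms] by (rule Lie_conj_eq_g2[OF assms(3,4)])

lemma conj_image_eq_iff:
  fixes g :: "real^'n^'n"
  assumes "g ** g' = mat 1"
  shows "(*v) (g' ** T ** g) ` H = H \<longleftrightarrow> (*v) T ` ((*v) g ` H) = (*v) g ` H"
proof -
  note gg = mat_inverse_cancel[OF assms]
  have "(*v) (g' ** T ** g) ` H = (*v) g' ` ((*v) T ` ((*v) g ` H))"
    by (simp add: image_image matrix_vector_mul_assoc matrix_mul_assoc)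
  moreover have "(*v) g ` ((*v) g' ` K) = K" "(*v) g' ` ((*v) g ` K) = K" for K
    by (simp_all add: image_image gg)
  ultimately show ?thesis by metis
qed

text \<open>Absence of zero divisors: left multiplication by an imaginary \<open>c\<close> squares
  to the scalar \<open>- (c \<bullet> c)\<close>.\<close>

lemma imaginary_mult_eq_0:
  assumes "c $ 0 = 0" "c \<star> x = 0" "c \<noteq> 0" shows "x = 0"
proof -
  have "2 *\<^sub>R (c \<star> c) = 2 *\<^sub>R (- (c \<bullet> c) *\<^sub>R e 0)"
    using oct_anticommute[of c c] assms(1) by (simp add: scaleR_2)
  then have "c \<star> c = - (c \<bullet> c) *\<^sub>R e 0"
    by (rule scaleR_left_imp_eq[rotated]) simp
  moreover have "(c \<star> c) \<star> x = 0"
    using oct_left_alternative[of c c x] assms(2) by (simp add: oct_mult_linear scaleR_2[symmetric])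
  ultimately have "(c \<bullet> c) *\<^sub>R x = 0" by (simp add: oct_mult_linear)
  then show ?thesis using assms(3) by simp
qed

text \<open>In the frame of \<open>Z_der_frame\<close>, failure to generate leaves only the
  invariance of the image of \<open>H45\<close> or \<open>H67\<close>. Both images contain
  \<open>e 1\<close>, so the invariant one contains \<open>T *v e 1\<close>.\<close>

lemma not_generating_imp_invariant:
  assumes T: "T \<in> G2" "T ** T = mat 1" and e1: "T *v e 1 \<noteq> e 1" "T *v e 1 \<noteq> - e 1" and HA: "(*v) T ` H_A \<noteq> H_A"
    and b: "b = b1 *\<^sub>R e 1 + b2 *\<^sub>R e 2 + b3 *\<^sub>R e 3" "b1\<^sup>2 + b2\<^sup>2 + b3\<^sup>2 = 2" "- sqrt 2 < b1"
    and not_gen: "Lie {Z_der (e 1) b, T ** Z_der (e 1) b ** T} \<noteq> g2"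
  shows "T *v e 1 \<in> twisted b (sqrt 2) \<or> T *v e 1 \<in> twisted b (- sqrt 2)"
proof -
  obtain g g' where g: "g \<in> G2" "g ** g' = mat 1" and Z: "Z_der (e 1) b = g ** Z0 ** g'" and ge1: "g *v e 1 = e 1"
    and gH: "(*v) g ` H_A = H_A" "(*v) g ` H45 \<subseteq> twisted b (sqrt 2)" "(*v) g ` H67 \<subseteq> twisted b (- sqrt 2)"
    using Z_der_frame[OF b] .
  note gg = mat_inverse_cancel[OF g(2)]
  let ?T = "g' ** T ** g"
  have "?T *v e 1 = g' *v (T *v e 1)"
    by (simp add: matrix_vector_mul_assoc[symmetric] ge1)
  then have ne: "?T *v e 1 \<noteq> e 1" "?T *v e 1 \<noteq> - e 1"
    using gg(2)[of "T *v e 1"] e1 ge1 by (auto simp: mv_minus)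
  have "Lie {Z0, ?T ** Z0 ** ?T} \<noteq> g2"
    using not_gen Lie_pair_conj[OF T g, of Z0] unfolding Z by blast
  then have "(*v) ?T ` H45 = H45 \<or> (*v) ?T ` H67 = H67"
    using Lie_Z0_involution[OF conj_involution(1,2)[OF T g] ne] HA gH(1) by (auto simp: conj_image_eq_iff[OF g(2)])
  then have inv: "(*v) T ` (*v) g ` H45 = (*v) g ` H45 \<or> (*v) T ` (*v) g ` H67 = (*v) g ` H67"
    by (simp add: conj_image_eq_iff[OF g(2)])
  have "e 1 \<in> H45" "e 1 \<in> H67"
    by (simp_all add: H45_def H67_def e_nth)
  then have "e 1 \<in> (*v) g ` H45" "e 1 \<in> (*v) g ` H67"
    using ge1 by (metis image_eqI)+
  then show ?thesis using inv gH(2,3) by blast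
qed

lemma generating_pair:
  assumes T: "T \<in> G2" "T ** T = mat 1" and e1: "T *v e 1 \<noteq> e 1" "T *v e 1 \<noteq> - e 1" and HA: "(*v) T ` H_A \<noteq> H_A"
    and b: "b = b1 *\<^sub>R e 1 + b2 *\<^sub>R e 2 + b3 *\<^sub>R e 3" "b1\<^sup>2 + b2\<^sup>2 + b3\<^sup>2 = 2" "- sqrt 2 < b1"
    and c: "c = c1 *\<^sub>R e 1 + c2 *\<^sub>R e 2 + c3 *\<^sub>R e 3" "c1\<^sup>2 + c2\<^sup>2 + c3\<^sup>2 = 2" "- sqrt 2 < c1"
    and bc: "b \<noteq> c" "b \<noteq> - c"
  shows "Lie {Z_der (e 1) b, T ** Z_der (e 1) b ** T} = g2 \<or> Lie {Z_der (e 1) c, T ** Z_der (e 1) c ** T} = g2"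
proof (rule ccontr)
  assume "\<not> ?thesis"
  then obtain \<sigma> \<sigma>' where \<sigma>: "\<sigma>' = \<sigma> \<or> \<sigma>' = - \<sigma>" "T *v e 1 \<in> twisted b \<sigma>" "T *v e 1 \<in> twisted c \<sigma>'"
    using not_generating_imp_invariant[OF T e1 HA b] not_generating_imp_invariant[OF T e1 HA c]
    by (metis minus_minus)
  let ?p = "part2 (T *v e 1)"
  \<comment> \<open>\<open>b \<star> ?p\<close> and \<open>c \<star> ?p\<close> are, up to sign, the
    same multiple of \<open>?p \<star> e 1\<close>.\<close>
  have "(b - c) \<star> ?p = 0 \<or> (b + c) \<star> ?p = 0"
    using \<sigma> by (auto simp: twisted_def oct_mult_linear)
  moreover have "b - c \<noteq> 0" "b + c \<noteq> 0" "(b - c) $ 0 = 0" "(b + c) $ 0 = 0"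
    using bc by (auto simp: b(1) c(1) e_nth add_eq_0_iff2)
  ultimately have "?p = 0"
    using imaginary_mult_eq_0 by blast
  then have "(T *v e 1) $ 4 = 0" "(T *v e 1) $ 5 = 0" "(T *v e 1) $ 6 = 0" "(T *v e 1) $ 7 = 0"
    by (simp_all add: part2_def vec_eq_8 e_nth)
  moreover have "(T *v e 1) $ 2 = 0" "(T *v e 1) $ 3 = 0"
    using \<sigma>(2) by (simp_all add: twisted_def)
  ultimately show False
    using G2_imaginary_unit[OF T(1)] e1 by blast
qed

text \<open>\<open>cyc\<close> fixes \<open>e 4\<close> and preserves \<open>H_A\<close>, so it
  rotates both arguments; the check is an intertwining identity in root coordinates.\<close>

lemma cyc_conj_Z_der:
  "cyc ** Z_der (e 1) (b2 *\<^sub>R e 1 + b3 *\<^sub>R e 2 + b1 *\<^sub>R e 3) ** (cyc ** cyc)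
    = Z_der (e 2) (b1 *\<^sub>R e 1 + b2 *\<^sub>R e 2 + b3 *\<^sub>R e 3)" (is "?l = ?r")
proof -
  have "cyc ** gmat (Complex 0 0) 0 0 0 0 (Complex b1 (- b3)) (Complex 2 (b2 - 1))
    = gmat (Complex 0 (- 1)) 0 0 0 0 (Complex b3 (- b2)) (Complex 0 b1) ** cyc"
    by (simp add: vec_eq_8 matrix_matrix_8 gmat_def cyc_def e_nth)
  then have "cyc ** Z_der (e 1) (b2 *\<^sub>R e 1 + b3 *\<^sub>R e 2 + b1 *\<^sub>R e 3)
      = Z_der (e 2) (b1 *\<^sub>R e 1 + b2 *\<^sub>R e 2 + b3 *\<^sub>R e 3) ** cyc"
    using Z_der_gmat[of 1 0 0 b2 b3 b1] Z_der_gmat[of 0 1 0 b1 b2 b3] by simp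
  then show ?thesis using mat_inverse_cancel(4)[OF cyc_inverse] by simp
qed

lemma generating_U:
  assumes T: "T \<in> G2" "T ** T = mat 1" and HA: "(*v) T ` H_A \<noteq> H_A"
  shows "\<exists>i\<in>{1,2}. \<exists>j\<in>{1,2,3}. Lie {U i j, T ** U i j ** T} = g2"
proof -
  have scale: "Lie {6 *\<^sub>R Z, T ** (6 *\<^sub>R Z) ** T} = Lie {Z, T ** Z ** T}" for Z
    using Lie_scaleR[of 6 Z "T ** Z ** T"] by (simp add: linear_scale[OF linear_conj])
  \<comment> \<open>In both applications of \<open>generating_pair\<close> the first coordinates of
    the vectors are 0 or 1.\<close>
  have s: "- sqrt 2 < 0" "- sqrt 2 < 1" by (auto intro: less_trans[of _ 0])
  \<comment> \<open>If the lines of \<open>e 1\<close> and \<open>e 2\<close> are both preserved, so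
    is that of their product \<open>e 3\<close>, and with it \<open>H_A\<close>.\<close>
  consider (e1) "T *v e 1 \<noteq> e 1" "T *v e 1 \<noteq> - e 1" | (e2) "T *v e 2 \<noteq> e 2" "T *v e 2 \<noteq> - e 2"
    | (fixed) "T *v e 1 = e 1 \<or> T *v e 1 = - e 1" "T *v e 2 = e 2 \<or> T *v e 2 = - e 2"
    by blast
  then show ?thesis
  proof cases
    case e1
    have "Lie {Z_der (e 1) (e 1 + e 2), T ** Z_der (e 1) (e 1 + e 2) ** T} = g2
       \<or> Lie {Z_der (e 1) (e 1 + e 3), T ** Z_der (e 1) (e 1 + e 3) ** T} = g2"
      by (rule generating_pair[OF T e1 HA, of _ 1 1 0 _ 1 0 1]) (use s in \<open>auto simp: vec_eq_8 e_nth\<close>)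
    then have "Lie {U 1 1, T ** U 1 1 ** T} = g2 \<or> Lie {U 1 2, T ** U 1 2 ** T} = g2"
      unfolding U_def scale by (simp add: a_vec_def b_vec_def)
    then show ?thesis by blast
  next
    case e2
    note c = cyc_G2 cyc_inverse
    note cc = mat_inverse_cancel[OF c(2)]
    let ?T = "(cyc ** cyc) ** T ** cyc"
    have cyc_e1: "cyc *v e 1 = e 2" by (simp add: vec_eq_8 matrix_vector_8 cyc_def e_nth)
    have "cyc *v (?T *v e 1) = T *v e 2"
      using cc(2) by (simp add: matrix_vector_mul_assoc[symmetric] cyc_e1)
    then have ne: "?T *v e 1 \<noteq> e 1" "?T *v e 1 \<noteq> - e 1"
      using e2 cyc_e1 by (auto simp: mv_minus)
    have "(*v) cyc ` H_A = H_A"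
    proof -
      have "cyc *v x \<in> H_A" if "x \<in> H_A" for x
        using that by (simp add: H_A_iff matrix_vector_8 cyc_def e_nth)
      moreover have "x = cyc *v ((cyc ** cyc) *v x)" for x by (simp add: cc)
      ultimately show ?thesis by (auto simp: image_iff matrix_vector_mul_assoc[symmetric]) metis
    qed
    then have HA': "(*v) ?T ` H_A \<noteq> H_A"
      using HA by (simp add: conj_image_eq_iff[OF c(2)])
    \<comment> \<open>Pulled back by \<open>cyc\<close>, the vectors \<open>b_vec 1\<close> and
      \<open>b_vec 2\<close> become \<open>e 1 + e 3\<close> and \<open>e 2 + e 3\<close>.\<close>
    have U2: "cyc ** Z_der (e 1) (e 1 + e 3) ** (cyc ** cyc) = Z_der (e 2) (e 1 + e 2)"
      "cyc ** Z_der (e 1) (e 2 + e 3) ** (cyc ** cyc) = Z_der (e 2) (e 1 + e 3)"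
      using cyc_conj_Z_der[of 1 0 1] cyc_conj_Z_der[of 0 1 1] by simp_all
    have "Lie {Z_der (e 1) (e 1 + e 3), ?T ** Z_der (e 1) (e 1 + e 3) ** ?T} = g2
       \<or> Lie {Z_der (e 1) (e 2 + e 3), ?T ** Z_der (e 1) (e 2 + e 3) ** ?T} = g2"
      by (rule generating_pair[OF conj_involution(1,2)[OF T c] ne HA', of _ 1 0 1 _ 0 1 1])
        (use s in \<open>auto simp: vec_eq_8 e_nth\<close>)
    then have "Lie {U 2 1, T ** U 2 1 ** T} = g2 \<or> Lie {U 2 2, T ** U 2 2 ** T} = g2"
      unfolding U_def scale Lie_pair_conj[OF T c, symmetric]
      by (simp add: a_vec_def b_vec_def U2)
    then show ?thesis by blast
  next
    case fixed
    have "T *v e 3 = (T *v e 1) \<star> (T *v e 2)"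
      using G2_mult[OF T(1), of "e 1" "e 2"] by (simp add: e_mult_table)
    then have e3: "T *v e 3 = e 3 \<or> T *v e 3 = - e 3"
      using fixed by (auto simp: oct_mult_linear e_mult_table)
    have inv: "T *v x \<in> H_A" if "x \<in> H_A" for x
    proof -
      have "x = x$0 *\<^sub>R e 0 + x$1 *\<^sub>R e 1 + x$2 *\<^sub>R e 2 + x$3 *\<^sub>R e 3"
        using that by (simp add: H_A_iff vec_eq_8 e_nth)
      then have "T *v x = x$0 *\<^sub>R (T *v e 0) + x$1 *\<^sub>R (T *v e 1) + x$2 *\<^sub>R (T *v e 2) + x$3 *\<^sub>R (T *v e 3)"
        by (metis matrix_vector_right_distrib matrix_vector_mult_scaleR)
      then show ?thesis using fixed e3 G2_e0[OF T(1)] by (auto simp: H_A_iff e_nth)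
    qed
    have "(*v) T ` H_A = H_A"
      using inv mv_involution[OF T(2)] by (auto simp: image_iff) metis
    then show ?thesis using HA by blast
  qed
qed

section \<open>Polynomial conditions and null sets\<close>

text \<open>On the line the function is a polynomial in \<open>t\<close> with constant coefficient
  \<open>p 0\<close>.\<close>

lemma finite_zeros_on_line:
  fixes p :: "'a::real_normed_vector \<Rightarrow> real"
  assumes p: "real_polynomial_function p" "p 0 \<noteq> 0"
  shows "finite {t. p (t *\<^sub>R x) = 0}"
proof -
  have "real_polynomial_function (p \<circ> (\<lambda>t::real. t *\<^sub>R x))"
    using p(1) by (intro real_polynomial_function_compose polynomial_function_bounded_linear bounded_linear_scaleR_left)
  then obtain a n where a: "\<And>t. p (t *\<^sub>R x) = (\<Sum>i\<le>n. a i * t ^ i)"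
    unfolding real_polynomial_function_iff_sum by (auto simp: fun_eq_iff)
  have "(\<Sum>i\<le>n. a i * 0 ^ i) \<noteq> 0" using p(2) a[of 0] by simp
  then have "\<exists>i\<le>n. a i \<noteq> 0" by (metis (no_types, lifting) atMost_iff mult_zero_left sum.neutral)
  then show ?thesis unfolding a by (simp only: polyfun_finite_roots)
qed

text \<open>Every line through a point where the polynomial does not vanish contains only finitely many zeros, so by
  Fubini almost all dilations of the zero set about that point are null sets.\<close>

lemma negligible_zeros_nonzero_at_0:
  fixes p :: "'a::euclidean_space \<Rightarrow> real"
  assumes p: "real_polynomial_function p" "p 0 \<noteq> 0"
  shows "negligible {x. p x = 0}"
proof -
  have cont: "continuous_on UNIV p"
    using continuous_on_polymonial_function p(1) by (simp add: real_polynomial_function_eq)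
  have [measurable]: "p \<in> borel_measurable borel"
    using cont by (rule borel_measurable_continuous_onI)
  have "AE t in lborel. p (t *\<^sub>R x) \<noteq> 0" for x
  proof -
    have "{t. p (t *\<^sub>R x) = 0} \<in> null_sets lborel"
      using finite_zeros_on_line[OF p] by (intro finite_imp_null_set_lborel)
    then show ?thesis using AE_not_in by force
  qed
  moreover have "{z \<in> space ((lborel :: 'a measure) \<Otimes>\<^sub>M (lborel :: real measure)). p (snd z *\<^sub>R fst z) \<noteq> 0}
      \<in> sets ((lborel :: 'a measure) \<Otimes>\<^sub>M (lborel :: real measure))"
    by measurable
  ultimately have "AE t in lborel. AE x in lborel. p (t *\<^sub>R x) \<noteq> 0"
    using lborel_pair.AE_commute[of "\<lambda>x t. p (t *\<^sub>R x) \<noteq> 0"] by simp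
  moreover have "AE t in lborel. t \<noteq> (0::real)"
    by (rule AE_lborel_singleton)
  ultimately have "AE t in lborel. t \<noteq> 0 \<and> (AE x in lborel. p (t *\<^sub>R x) \<noteq> 0)"
    by auto
  \<comment> \<open>Nontriviality of the filter allows one nonzero \<open>t\<close> to be picked
    from the almost everywhere statement.\<close>
  moreover have "ae_filter (lborel :: real measure) \<noteq> bot"
    by (simp add: ae_filter_eq_bot_iff)
  ultimately obtain t :: real where t: "t \<noteq> 0" "AE x in lborel. p (t *\<^sub>R x) \<noteq> 0"
    using eventually_happens by blast
  have "{x. p (t *\<^sub>R x) = 0} \<in> null_sets lborel"
    using t(2) by (subst (asm) AE_iff_null) auto
  then have "negligible {x. p (t *\<^sub>R x) = 0}"
    by (simp add: negligible_iff_null_sets null_sets_completionI)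
  then have "negligible ((*\<^sub>R) t ` {x. p (t *\<^sub>R x) = 0})"
    by (intro negligible_differentiable_image_negligible linear_imp_differentiable_on linear_scaleR) simp_all
  also have "(*\<^sub>R) t ` {x. p (t *\<^sub>R x) = 0} = {x. p x = 0}"
  proof (intro equalityI subsetI)
    fix x assume "x \<in> {x. p x = 0}"
    then show "x \<in> (*\<^sub>R) t ` {x. p (t *\<^sub>R x) = 0}"
      using t(1) by (intro image_eqI[of _ _ "(1 / t) *\<^sub>R x"]) auto
  qed auto
  finally show ?thesis .
qed

text \<open>Translation moves the point of nonvanishing to the origin.\<close>

lemma negligible_polynomial_zeros:
  fixes p :: "'a::euclidean_space \<Rightarrow> real"
  assumes p: "real_polynomial_function p" "p x0 \<noteq> 0"
  shows "negligible {x. p x = 0}"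
proof -
  have "polynomial_function (\<lambda>x. x0 + x)"
    by (intro polynomial_function_add polynomial_function_const polynomial_function_id[unfolded id_def])
  then have "real_polynomial_function (p \<circ> (\<lambda>x. x0 + x))"
    using p(1) by (rule real_polynomial_function_compose)
  then have "negligible {x. (p \<circ> (\<lambda>x. x0 + x)) x = 0}"
    by (rule negligible_zeros_nonzero_at_0) (simp add: p)
  then have "negligible ((+) x0 ` {x. (p \<circ> (\<lambda>x. x0 + x)) x = 0})"
    by (rule negligible_translation)
  also have "(+) x0 ` {x. (p \<circ> (\<lambda>x. x0 + x)) x = 0} = {x. p x = 0}"
    by (auto intro!: image_eqI[of _ "(+) x0" "_ - x0"])
  finally show ?thesis .
qed

section \<open>Iterated brackets and polynomial criteria for generation\<close>

datatype lie_word = Fst | Snd | Br lie_word lie_word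

text \<open>Words are syntax, so that the brackets spanning at one pair can be evaluated at another,
  with entries polynomial in those of the pair.\<close>

primrec lie_eval :: "endo \<Rightarrow> endo \<Rightarrow> lie_word \<Rightarrow> endo" where
  "lie_eval X Y Fst = X"
| "lie_eval X Y Snd = Y"
| "lie_eval X Y (Br u v) = lie_bracket (lie_eval X Y u) (lie_eval X Y v)"

lemma lie_eval_in_Lie: "lie_eval X Y w \<in> Lie {X, Y}"
  using Lie_superset[of "{X, Y}"] lie_subalgebra_Lie[of "{X, Y}"]
  by (induction w) (auto simp: lie_subalgebra_def)

lemma lie_bracket_swap: "lie_bracket Y X = - lie_bracket X Y"
  by (simp add: lie_bracket_def)

text \<open>The span of the words is closed under brackets by bilinearity: a word on the left comes
  first, then antisymmetry handles the other argument.\<close>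

lemma Lie_eq_span_words: "Lie {X, Y} = span (range (lie_eval X Y))"
proof (rule antisym)
  let ?S = "range (lie_eval X Y)"
  have base: "lie_bracket u v \<in> span ?S" if uv: "u \<in> ?S" "v \<in> ?S" for u v
  proof -
    obtain a b where "u = lie_eval X Y a" "v = lie_eval X Y b" using uv by auto
    then show ?thesis using span_base[OF rangeI[of "lie_eval X Y" "Br a b"]] by simp
  qed
  have left: "lie_bracket u A \<in> span ?S" if "u \<in> ?S" "A \<in> span ?S" for u A
  proof -
    have "span ?S \<subseteq> {A. lie_bracket u A \<in> span ?S}"
    proof (rule span_minimal)
      show "subspace {A. lie_bracket u A \<in> span ?S}"
        by (intro linear_subspace_linear_preimage linear_lie_bracket subspace_span)
    qed (use base that in auto)
    then show ?thesis using that by blast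
  qed
  have "lie_bracket A B \<in> span ?S" if "A \<in> span ?S" "B \<in> span ?S" for A B
  proof -
    have "span ?S \<subseteq> {A. lie_bracket B A \<in> span ?S}"
    proof (rule span_minimal)
      show "subspace {A. lie_bracket B A \<in> span ?S}"
        by (intro linear_subspace_linear_preimage linear_lie_bracket subspace_span)
      show "?S \<subseteq> {A. lie_bracket B A \<in> span ?S}"
        using span_neg[OF left[OF _ that(2)]] by (auto simp: lie_bracket_swap[of B])
    qed
    then have "lie_bracket B A \<in> span ?S" using that(1) by blast
    then show ?thesis using span_neg unfolding lie_bracket_swap[of A B] by blast
  qed
  then have "lie_subalgebra (span ?S)" by (simp add: lie_subalgebra_def)
  moreover have "X \<in> ?S" "Y \<in> ?S"
    by (rule range_eqI[of _ _ Fst] range_eqI[of _ _ Snd]; simp)+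
  ultimately show "Lie {X, Y} \<subseteq> span ?S"
    by (intro Lie_minimal) (auto intro: span_base)
  show "span ?S \<subseteq> Lie {X, Y}"
    using lie_eval_in_Lie lie_subalgebra_Lie by (intro span_minimal) (auto simp: lie_subalgebra_def)
qed

lemma polynomial_entries_mult:
  fixes F G :: "'a::real_normed_vector \<Rightarrow> endo"
  assumes "\<And>i j. real_polynomial_function (\<lambda>Z. F Z $ i $ j)" "\<And>i j. real_polynomial_function (\<lambda>Z. G Z $ i $ j)"
  shows "real_polynomial_function (\<lambda>Z. (F Z ** G Z) $ i $ j)"
  unfolding matrix_matrix_mult_def vec_lambda_beta
  by (intro real_polynomial_function_sum real_polynomial_function.intros(4) finite assms)

lemma polynomial_entries_lie_eval:
  fixes F G :: "'a::real_normed_vector \<Rightarrow> endo"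
  assumes "\<And>i j. real_polynomial_function (\<lambda>Z. F Z $ i $ j)" "\<And>i j. real_polynomial_function (\<lambda>Z. G Z $ i $ j)"
  shows "real_polynomial_function (\<lambda>Z. lie_eval (F Z) (G Z) w $ i $ j)"
proof (induction w arbitrary: i j)
  case (Br u v)
  show ?case
    by (simp add: lie_bracket_def) (intro real_polynomial_function_diff polynomial_entries_mult Br)
qed (use assms in auto)

text \<open>The index type \<open>8 \<times> 8\<close> numbers both the members of the family and
  the entries of each, so 64 endomorphisms form a square matrix.\<close>

definition family_det :: "(8 \<times> 8 \<Rightarrow> endo) \<Rightarrow> real"
  where "family_det G = det (\<chi> k l. G k $ fst l $ snd l)"

lemma family_det_nonzero_iff: "family_det G \<noteq> 0 \<longleftrightarrow> (\<forall>c. (\<Sum>k\<in>UNIV. c k *\<^sub>R G k) = 0 \<longrightarrow> (\<forall>k. c k = 0))"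
proof -
  have "(\<Sum>k\<in>UNIV. c k *s row k (\<chi> k l. G k $ fst l $ snd l)) = 0 \<longleftrightarrow> (\<Sum>k\<in>UNIV. c k *\<^sub>R G k) = 0" for c
    by (simp add: vec_eq_iff row_def)
  then show ?thesis
    unfolding family_det_def invertible_det_nz[symmetric] invertible_right_inverse
      matrix_right_invertible_independent_rows by simp
qed

lemma polynomial_family_det:
  fixes G :: "'a::real_normed_vector \<Rightarrow> 8 \<times> 8 \<Rightarrow> endo"
  assumes "\<And>k i j. real_polynomial_function (\<lambda>Z. G Z k $ i $ j)"
  shows "real_polynomial_function (\<lambda>Z. family_det (G Z))"
  unfolding family_det_def det_def vec_lambda_beta
  by (intro real_polynomial_function_sum real_polynomial_function.intros(4) real_polynomial_function.intros(2)
      real_polynomial_function_prod finite_permutations finite assms)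

lemma family_det_independent:
  assumes "family_det G \<noteq> 0"
  shows "inj G" "independent (range G)"
proof -
  note ind = assms[unfolded family_det_nonzero_iff, rule_format]
  show inj: "inj G"
  proof (rule injI, rule ccontr)
    fix k l assume kl: "G k = G l" "k \<noteq> l"
    have delta: "(\<Sum>j\<in>UNIV. (if j = i then 1 else 0) *\<^sub>R G j) = G i" for i
      by (subst sum.remove[of _ i]) (auto intro!: sum.neutral)
    have "(\<Sum>j\<in>UNIV. ((if j = k then 1 else 0) - (if j = l then 1 else 0)) *\<^sub>R G j) = G k - G l"
      by (simp only: scaleR_left_diff_distrib sum_subtractf delta)
    also have "\<dots> = 0" using kl(1) by (simp only: diff_self)
    finally have "(if k = k then 1 else 0) - (if k = l then 1 else 0) = (0::real)"
      by (rule ind)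
    then show False using kl(2) by simp
  qed
  show "independent (range G)"
  proof
    assume "dependent (range G)"
    then obtain u v where u: "v \<in> range G" "u v \<noteq> 0" "(\<Sum>v\<in>range G. u v *\<^sub>R v) = 0"
      by (auto simp: dependent_finite)
    have "(\<Sum>k\<in>UNIV. u (G k) *\<^sub>R G k) = 0"
      using u(3) unfolding sum.reindex[OF inj] o_def .
    then have "u (G k) = 0" for k by (rule ind)
    then show False using u(1,2) by blast
  qed
qed

text \<open>Words spanning \<open>g2\<close> at \<open>W\<close> are completed to a basis of all
  endomorphisms, and the polynomial is the determinant of this family as a function of
  \<open>Z\<close>. Where it does not vanish, the words remain independent, and there are
  \<open>dim g2\<close> of them.\<close>

lemma generating_polynomial:
  assumes T: "T \<in> G2" "T ** T = mat 1" and W: "W \<in> g2" and gen: "Lie {W, T ** W ** T} = g2"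
  shows "\<exists>p. real_polynomial_function p \<and> p W \<noteq> 0 \<and> (\<forall>Z\<in>g2. p Z \<noteq> 0 \<longrightarrow> Lie {Z, T ** Z ** T} = g2)"
proof -
  have "span (range (lie_eval W (T ** W ** T))) = g2"
    using gen unfolding Lie_eq_span_words .
  moreover obtain B where B: "B \<subseteq> range (lie_eval W (T ** W ** T))" "independent B"
      "range (lie_eval W (T ** W ** T)) \<subseteq> span B"
    using maximal_independent_subset[of "range (lie_eval W (T ** W ** T))"] by auto
  ultimately have spanB: "span B = g2"
    using span_minimal[OF B(3) subspace_span] span_mono[OF B(1)] by auto
  obtain B' where B': "B \<subseteq> B'" "independent B'" "UNIV \<subseteq> span B'"
    using maximal_independent_subset_extend[OF subset_UNIV B(2)] by auto
  have fin: "finite B'" using B'(2) by (rule finiteI_independent)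
  have "card B' = DIM(endo)"
    using basis_card_eq_dim[OF subset_UNIV B'(3,2)] by simp
  then have "card (UNIV :: (8 \<times> 8) set) = card B'" by simp
  from finite_same_card_bij[OF finite fin this] obtain h :: "8 \<times> 8 \<Rightarrow> endo" where h: "bij_betw h UNIV B'"
    by (rule exE)
  have "\<forall>b\<in>B. \<exists>w. b = lie_eval W (T ** W ** T) w" using B(1) by auto
  then obtain w where w: "\<And>b. b \<in> B \<Longrightarrow> b = lie_eval W (T ** W ** T) (w b)" by metis
  \<comment> \<open>Only the members coming from words vary with \<open>Z\<close>; the completing
    basis vectors stay constant.\<close>
  define G where "G Z k = (if h k \<in> B then lie_eval Z (T ** Z ** T) (w (h k)) else h k)" for Z k
  show ?thesis
  proof (rule exI[of _ "\<lambda>Z. family_det (G Z)"], intro conjI ballI impI)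
    have entry: "real_polynomial_function (\<lambda>Z :: endo. Z $ i $ j)" for i j
      by (rule real_polynomial_function.intros(1), rule bounded_linear_compose[OF bounded_linear_vec_nth bounded_linear_vec_nth])
    have "real_polynomial_function (\<lambda>Z. G Z k $ i $ j)" for k i j
      unfolding G_def using entry
      by (cases "h k \<in> B", simp_all only: if_True if_False)
        (intro polynomial_entries_lie_eval polynomial_entries_mult real_polynomial_function.intros(2) entry)+
    then show "real_polynomial_function (\<lambda>Z. family_det (G Z))" by (rule polynomial_family_det)
    have GW: "G W = h" using w by (auto simp: G_def fun_eq_iff)
    show "family_det (G W) \<noteq> 0"
      unfolding GW family_det_nonzero_iff
    proof (intro allI impI)
      fix c k assume c: "(\<Sum>k\<in>UNIV. c k *\<^sub>R h k) = 0"
      have "(\<Sum>b\<in>B'. c (inv h b) *\<^sub>R b) = (\<Sum>k\<in>UNIV. c k *\<^sub>R h k)"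
        using h by (subst sum.reindex_bij_betw[OF h, symmetric]) (auto simp: bij_betw_def inv_f_f)
      then have "c (inv h (h k)) = 0"
        using independentD[OF B'(2) fin subset_refl, of "\<lambda>b. c (inv h b)" "h k"] c h by (auto simp: bij_betw_def)
      then show "c k = 0" using h by (simp add: bij_betw_def inv_f_f)
    qed
    fix Z assume Z: "Z \<in> g2" "family_det (G Z) \<noteq> 0"
    have sub: "Lie {Z, T ** Z ** T} \<subseteq> g2"
      using Z g2_conj[OF T Z(1)] by (intro Lie_minimal lie_subalgebra_g2) auto
    \<comment> \<open>The indices of the members given by words.\<close>
    define K where "K = {k. h k \<in> B}"
    have "h ` K = B" using h B'(1) by (auto simp: K_def bij_betw_def)
    moreover have "inj_on h K" using h by (auto simp: bij_betw_def inj_on_def)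
    ultimately have "card K = card B" using card_image by metis
    also have "\<dots> = dim g2"
      using dim_eq_card_independent[OF B(2)] dim_span[of B] spanB by simp
    finally have cardK: "card K = dim g2" .
    note ind = family_det_independent[OF Z(2)]
    have mem: "G Z ` K \<subseteq> Lie {Z, T ** Z ** T}"
      using lie_eval_in_Lie by (auto simp: K_def G_def)
    have "independent (G Z ` K)" using ind(2) by (rule independent_mono) auto
    moreover have "card (G Z ` K) = dim g2"
      using cardK card_image[OF inj_on_subset[OF ind(1) subset_UNIV]] by simp
    moreover have "G Z ` K \<subseteq> g2" using mem sub by blast
    ultimately have "g2 \<subseteq> span (G Z ` K)"
      using card_eq_dim[of "G Z ` K" g2] by simp
    also have "\<dots> \<subseteq> Lie {Z, T ** Z ** T}"
      using mem lie_subalgebra_Lie by (intro span_minimal) (auto simp: lie_subalgebra_def)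
    finally show "Lie {Z, T ** Z ** T} = g2" using sub by blast
  qed
qed

section \<open>The theorem for a quaternionic context\<close>

text \<open>By \<open>generating_polynomial\<close> each generating element avoids the zeros of some
  member of \<open>P\<close>, the family of all polynomials whose nonvanishing on \<open>W\<close>
  forces generation.\<close>

lemma zariski_open_generating:
  assumes T: "T \<in> G2" "T ** T = mat 1" and W: "W \<subseteq> g2"
  shows "zariski_open_in W {Z \<in> W. Lie {Z, T ** Z ** T} = g2}" (is "zariski_open_in W ?S")
proof -
  define P where "P = {p. real_polynomial_function p \<and> (\<forall>Z\<in>W. p Z \<noteq> 0 \<longrightarrow> Lie {Z, T ** Z ** T} = g2)}"
  have "W - ?S = {Z \<in> W. \<forall>p\<in>P. p Z = 0}"
  proof (intro equalityI subsetI)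
    fix Z assume "Z \<in> W - ?S"
    then show "Z \<in> {Z \<in> W. \<forall>p\<in>P. p Z = 0}" by (auto simp: P_def)
  next
    fix Z assume Z: "Z \<in> {Z \<in> W. \<forall>p\<in>P. p Z = 0}"
    have "Lie {Z, T ** Z ** T} \<noteq> g2"
    proof
      assume gen: "Lie {Z, T ** Z ** T} = g2"
      have "Z \<in> g2" using Z W by auto
      from generating_polynomial[OF T this gen] obtain p where p: "real_polynomial_function p" "p Z \<noteq> 0"
        "\<forall>Z\<in>g2. p Z \<noteq> 0 \<longrightarrow> Lie {Z, T ** Z ** T} = g2" by blast
      then have "p \<in> P" using W by (auto simp: P_def)
      then show False using Z p(2) by simp
    qed
    then show "Z \<in> W - ?S" using Z by blast
  qed
  moreover have "\<forall>p\<in>P. real_polynomial_function p" by (simp add: P_def)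
  ultimately show ?thesis unfolding zariski_open_in_def by blast
qed

text \<open>One generating element yields a polynomial that is not identically zero on
  \<open>W\<close>; in the chart, the nongenerating elements lie among its zeros.\<close>

lemma null_nongenerating:
  assumes T: "T \<in> G2" "T ** T = mat 1" and W: "W \<subseteq> g2"
    and \<phi>: "linear \<phi>" "bij_betw \<phi> (UNIV :: (real^6) set) W"
    and Z: "Z \<in> W" "Lie {Z, T ** Z ** T} = g2"
  shows "null_in W (W - {Z \<in> W. Lie {Z, T ** Z ** T} = g2})" (is "null_in W ?N")
proof -
  have "Z \<in> g2" using Z W by auto
  from generating_polynomial[OF T this Z(2)] obtain p where p: "real_polynomial_function p" "p Z \<noteq> 0"
    "\<forall>Z\<in>g2. p Z \<noteq> 0 \<longrightarrow> Lie {Z, T ** Z ** T} = g2" by blast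
  obtain z where z: "\<phi> z = Z" using \<phi>(2) Z(1) by (auto simp: bij_betw_def)
  have "real_polynomial_function (p \<circ> \<phi>)"
    using \<phi>(1) p(1) by (intro real_polynomial_function_compose polynomial_function_bounded_linear)
      (simp_all add: linear_conv_bounded_linear)
  then have "negligible {x. (p \<circ> \<phi>) x = 0}"
    by (rule negligible_polynomial_zeros[of _ z]) (simp add: z p(2))
  moreover have "{x. \<phi> x \<in> ?N} \<subseteq> {x. (p \<circ> \<phi>) x = 0}"
    using p(3) W by auto
  ultimately have "negligible {x. \<phi> x \<in> ?N}" by (rule negligible_subset)
  then show ?thesis unfolding null_in_def using \<phi> by blast
qed

section \<open>Linear coordinates on \<open>\<kk> H_A\<close>\<close>

lemma UNIV_6: "(UNIV :: 6 set) = {1,2,3,4,5,6}"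
proof -
  have "card {1,2,3,4,5,6::6} = CARD(6)" by simp
  then show ?thesis by (metis card_subset_eq finite subset_UNIV)
qed

text \<open>Keeping the images of \<open>e 1\<close> and \<open>e 2\<close> in \<open>H_A\<close>
  already kills the four other complex coordinates.\<close>

lemma k_H_A_iff: "D \<in> \<kk> H_A \<longleftrightarrow> (\<exists>x l t. D = gmat x 0 0 0 0 l t)"
proof
  assume D: "D \<in> \<kk> H_A"
  then have "D \<in> g2" by (simp add: \<kk>_def)
  then obtain x1 x2 x3 l12 l13 l23 t where eq: "D = gmat x1 x2 x3 l12 l13 l23 t"
    by (rule g2_gmat)
  have "D *v e 1 \<in> H_A" "D *v e 2 \<in> H_A"
    using D by (auto simp: \<kk>_def H_A_iff e_nth)
  then have "x2 = 0" "x3 = 0" "l12 = 0" "l13 = 0"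
    unfolding eq gmat_apply by (auto simp: H_A_iff complex_eq_iff)
  then show "\<exists>x l t. D = gmat x 0 0 0 0 l t" using eq by blast
next
  assume "\<exists>x l t. D = gmat x 0 0 0 0 l t"
  then obtain x l t where eq: "D = gmat x 0 0 0 0 l t" by blast
  show "D \<in> \<kk> H_A"
    unfolding eq \<kk>_def mem_Collect_eq by (intro conjI gmat_in_g2) (auto simp: H_A_iff gmat_def matrix_vector_8)
qed

definition k_chart :: "real^6 \<Rightarrow> endo"
  where "k_chart p = gmat (Complex (p$1) (p$2)) 0 0 0 0 (Complex (p$3) (p$4)) (Complex (p$5) (p$6))"

lemma linear_k_chart: "linear k_chart"
  by (rule linearI) (simp_all add: k_chart_def gmat_def vec_eq_8 algebra_simps)

lemma bij_k_chart: "bij_betw k_chart UNIV (\<kk> H_A)"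
  unfolding bij_betw_def
proof
  show "inj k_chart"
  proof (rule injI)
    fix p q assume eq: "k_chart p = k_chart q"
    have "k_chart p *v e 1 = k_chart q *v e 1" "k_chart p *v e 2 = k_chart q *v e 2" "k_chart p *v e 4 = k_chart q *v e 4"
      using eq by simp_all
    then have "p$i = q$i" for i
      using UNIV_I[of i] unfolding UNIV_6 k_chart_def gmat_apply by (auto simp: vec_eq_8)
    then show "p = q" by (simp add: vec_eq_iff)
  qed
  show "range k_chart = \<kk> H_A"
  proof (intro equalityI subsetI)
    fix D assume "D \<in> \<kk> H_A"
    then obtain x l t where D: "D = gmat x 0 0 0 0 l t" unfolding k_H_A_iff by blast
    define p :: "real^6" where "p = (\<chi> i. if i = 1 then Re x else if i = 2 then Im x else if i = 3 then Re l
      else if i = 4 then Im l else if i = 5 then Re t else Im t)"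
    have "D = k_chart p" by (simp add: D k_chart_def p_def)
    then show "D \<in> range k_chart" by blast
  qed (auto simp: k_H_A_iff k_chart_def)
qed

lemma lie_subalgebra_k:
  assumes "subspace H" shows "lie_subalgebra (\<kk> H)"
  unfolding lie_subalgebra_def
proof (intro conjI ballI)
  show "subspace (\<kk> H)"
    using subspace_g2 assms unfolding \<kk>_def subspace_def
    by (auto simp: matrix_vector_mult_add_rdistrib scaleR_matrix_vector_assoc[symmetric])
  fix X Y assume "X \<in> \<kk> H" "Y \<in> \<kk> H"
  then show "lie_bracket X Y \<in> \<kk> H"
    using lie_subalgebra_g2 subspace_diff[OF assms] unfolding \<kk>_def lie_subalgebra_def
    by (auto simp: lie_bracket_def matrix_vector_mult_diff_rdistrib matrix_vector_mul_assoc[symmetric])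
qed

lemma U_in_k: "U i j \<in> \<kk> H_A"
proof -
  have e: "e 1 = 1 *\<^sub>R e 1 + 0 *\<^sub>R e 2 + 0 *\<^sub>R e 3" "e 2 = 0 *\<^sub>R e 1 + 1 *\<^sub>R e 2 + 0 *\<^sub>R e 3"
    "e 1 + e 2 = 1 *\<^sub>R e 1 + 1 *\<^sub>R e 2 + 0 *\<^sub>R e 3" "e 1 + e 3 = 1 *\<^sub>R e 1 + 0 *\<^sub>R e 2 + 1 *\<^sub>R e 3"
    "e 2 + e 3 = 0 *\<^sub>R e 1 + 1 *\<^sub>R e 2 + 1 *\<^sub>R e 3" by simp_all
  obtain a1 a2 a3 where a: "a_vec i = a1 *\<^sub>R e 1 + a2 *\<^sub>R e 2 + a3 *\<^sub>R e 3"
    unfolding a_vec_def using e(1,2) by metis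
  obtain b1 b2 b3 where b: "b_vec j = b1 *\<^sub>R e 1 + b2 *\<^sub>R e 2 + b3 *\<^sub>R e 3"
    unfolding b_vec_def using e(3-) by metis
  have "Z_der (a_vec i) (b_vec j) \<in> \<kk> H_A"
    unfolding a b Z_der_gmat k_H_A_iff by blast
  then show ?thesis
    unfolding U_def using lie_subalgebra_k[OF subspace_H(1)] by (simp add: lie_subalgebra_def subspace_scale)
qed

text \<open>Both generators lie in the subalgebra \<open>\<kk> H_A\<close>, which is proper.\<close>

lemma not_generating_invariant:
  assumes T: "T \<in> G2" "T ** T = mat 1" and H: "(*v) T ` H_A = H_A" and Z: "Z \<in> \<kk> H_A"
  shows "Lie {Z, T ** Z ** T} \<noteq> g2"
proof
  assume gen: "Lie {Z, T ** Z ** T} = g2"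
  have "T ** Z ** T \<in> g2" using g2_conj[OF T] Z by (simp add: \<kk>_def)
  moreover have "(T ** Z ** T) *v x \<in> H_A" if "x \<in> H_A" for x
  proof -
    have "T *v x \<in> H_A" using H that by blast
    then have "Z *v (T *v x) \<in> H_A" using Z by (simp add: \<kk>_def)
    then have "T *v (Z *v (T *v x)) \<in> H_A" using H by blast
    then show ?thesis by (simp add: matrix_vector_mul_assoc matrix_mul_assoc)
  qed
  ultimately have "T ** Z ** T \<in> \<kk> H_A" by (simp add: \<kk>_def)
  then have "Lie {Z, T ** Z ** T} \<subseteq> \<kk> H_A"
    using Z by (intro Lie_minimal lie_subalgebra_k subspace_H) auto
  \<comment> \<open>This element of \<open>g2\<close> sends \<open>e 1\<close> to a multiple of
    \<open>e 4\<close>, outside \<open>H_A\<close>.\<close>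
  then have "gmat 0 1 0 0 0 0 0 \<in> \<kk> H_A" using gen gmat_in_g2 by blast
  then have "gmat 0 1 0 0 0 0 0 *v e 1 \<in> H_A" by (simp add: \<kk>_def H_A_iff e_nth)
  then show False by (simp add: gmat_apply H_A_iff)
qed

text \<open>One inclusion is direct; the other is the same inclusion for the inverse.\<close>

lemma k_image:
  assumes g: "g \<in> G2" "g ** g' = mat 1"
  shows "\<kk> ((*v) g ` H) = (\<lambda>Z. g ** Z ** g') ` \<kk> H"
proof -
  have sub: "(\<lambda>Z. h ** Z ** h') ` \<kk> H \<subseteq> \<kk> ((*v) h ` H)" if h: "h \<in> G2" "h ** h' = mat 1" for h h' H
  proof -
    have "(h ** Z ** h') *v (h *v x) = h *v (Z *v x)" for Z x
      by (simp add: matrix_vector_mul_assoc[symmetric] mat_inverse_cancel[OF h(2)])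
    then show ?thesis using g2_conj[OF h] by (auto simp: \<kk>_def)
  qed
  note gg = mat_inverse_cancel[OF g(2)]
  have "(*v) g' ` (*v) g ` H = H" by (simp add: image_image gg)
  then have "g' ** Z ** g \<in> \<kk> H" if "Z \<in> \<kk> ((*v) g ` H)" for Z
    using sub[OF G2_inverse[OF g] gg(1), of "(*v) g ` H"] that by auto
  moreover have "Z = g ** (g' ** Z ** g) ** g'" for Z
    by (simp add: matrix_mul_assoc gg g(2))
  ultimately have "\<kk> ((*v) g ` H) \<subseteq> (\<lambda>Z. g ** Z ** g') ` \<kk> H" by blast
  then show ?thesis using sub[OF g] by blast
qed

text \<open>Conjugating back by \<open>g\<close> reduces to \<open>H_A\<close> and the involution
  \<open>?T\<close>. The conditions are linked in a cycle: if \<open>H\<close> moves, some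
  conjugated \<open>U i j\<close> generates; it lies in \<open>\<kk> H\<close>; and a generating
  element of \<open>\<kk> H\<close> forces \<open>H\<close> to move.\<close>

lemma context_equivalences:
  assumes T: "T \<in> G2" "T ** T = mat 1" and g: "g \<in> G2" "g ** g' = mat 1" and H: "H = (*v) g ` H_A"
  shows "((*v) T ` H \<noteq> H \<longleftrightarrow> (\<exists>Z\<in>\<kk> H. Lie {Z, T ** Z ** T} = g2)) \<and>
    ((*v) T ` H \<noteq> H \<longleftrightarrow>
      (\<exists>i\<in>{1,2}. \<exists>j\<in>{1,2,3}. Lie {g ** U i j ** g', T ** (g ** U i j ** g') ** T} = g2)) \<and>
    ((*v) T ` H \<noteq> H \<longrightarrow>
      {Z \<in> \<kk> H. Lie {Z, T ** Z ** T} = g2} \<noteq> {} \<and>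
      zariski_open_in (\<kk> H) {Z \<in> \<kk> H. Lie {Z, T ** Z ** T} = g2} \<and>
      null_in (\<kk> H) (\<kk> H - {Z \<in> \<kk> H. Lie {Z, T ** Z ** T} = g2}))"
proof -
  let ?T = "g' ** T ** g"
  let ?c = "\<lambda>Z. g ** Z ** g'"
  note T' = conj_involution(1,2)[OF T g]
  note pair = Lie_pair_conj[OF T g]
  have k: "\<kk> H = ?c ` \<kk> H_A" unfolding H by (rule k_image[OF g])
  have moved: "(*v) T ` H \<noteq> H \<longleftrightarrow> (*v) ?T ` H_A \<noteq> H_A"
    unfolding H conj_image_eq_iff[OF g(2)] ..
  have U_gen: "(*v) T ` H \<noteq> H \<Longrightarrow>
      \<exists>i\<in>{1,2}. \<exists>j\<in>{1,2,3}. Lie {?c (U i j), T ** ?c (U i j) ** T} = g2"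
    unfolding moved pair by (rule generating_U[OF T'])
  have U_k: "?c (U i j) \<in> \<kk> H" for i j unfolding k using U_in_k by blast
  have no_gen: "(*v) T ` H \<noteq> H" if Z: "Z \<in> \<kk> H" "Lie {Z, T ** Z ** T} = g2" for Z
  proof -
    obtain Y where Y: "Y \<in> \<kk> H_A" "Z = ?c Y" using Z(1) unfolding k by blast
    have "Lie {Y, ?T ** Y ** ?T} = g2" using Z(2) unfolding Y(2) pair .
    then show ?thesis
      using not_generating_invariant[OF T' _ Y(1)] unfolding moved by blast
  qed
  have "\<kk> H \<subseteq> g2" by (auto simp: \<kk>_def)
  note zar = zariski_open_generating[OF T this]
  have chart: "linear (?c \<circ> k_chart)" "bij_betw (?c \<circ> k_chart) UNIV (\<kk> H)"
  proof -
    show "linear (?c \<circ> k_chart)" by (rule linear_compose[OF linear_k_chart linear_conj])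
    have "inj ?c"
    proof (rule injI)
      fix X Y assume "?c X = ?c Y"
      then have "g' ** ?c X ** g = g' ** ?c Y ** g" by simp
      then show "X = Y" by (simp add: matrix_mul_assoc mat_inverse_cancel[OF g(2)])
    qed
    then have "bij_betw ?c (\<kk> H_A) (\<kk> H)"
      unfolding k by (auto simp: bij_betw_def intro: inj_on_subset)
    then show "bij_betw (?c \<circ> k_chart) UNIV (\<kk> H)" using bij_k_chart by (rule bij_betw_trans[rotated])
  qed
  note null = null_nongenerating[OF T \<open>\<kk> H \<subseteq> g2\<close> chart]
  show ?thesis
    using U_gen U_k no_gen zar null by blast
qed

text \<open>\<open>H\<close> and its orthogonal complement grade the octonions by parity, and the
  map that is 1 on the even part and -1 on the odd part of such a grading is multiplicative.\<close>

lemma quaternionic_reflection_involution: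
  assumes ctx: "quaternionic_context H" and refl: "quaternionic_reflection H T"
  shows "T \<in> G2" "T ** T = mat 1"
proof -
  have sub: "subspace H" and e0: "e 0 \<in> H" and mult: "\<And>x y. x \<in> H \<Longrightarrow> y \<in> H \<Longrightarrow> x \<star> y \<in> H"
    using ctx by (auto simp: quaternionic_context_def)
  obtain \<phi> :: "real \<times> (real^3) \<Rightarrow> real^8" where \<phi>: "linear \<phi>" "bij_betw \<phi> UNIV H"
    using ctx by (auto simp: quaternionic_context_def)
  let ?P = "H\<^sup>\<bottom>"
  have P: "y \<in> ?P \<longleftrightarrow> (\<forall>x\<in>H. x \<bullet> y = 0)" for y
    by (auto simp: orthogonal_comp_def orthogonal_def)
  note subP = subspace_orthogonal_comp[of H]
  have "dim H = 4"
    using dim_image_eq[OF \<phi>(1), of UNIV] \<phi>(2) by (simp add: bij_betw_def)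
  moreover have "dim {y \<in> UNIV. \<forall>x\<in>H. orthogonal x y} + dim H = dim (UNIV :: (real^8) set)"
    by (rule dim_subspace_orthogonal_to_vectors) (use sub in auto)
  ultimately have dimP: "dim ?P = 4" "dim H = 4" by (simp_all add: orthogonal_comp_def)
  have conj: "(2 * x $ 0) *\<^sub>R e 0 - x \<in> H" if "x \<in> H" for x
    using that sub e0 by (simp add: subspace_diff subspace_scale)
  \<comment> \<open>The adjoint of left multiplication by \<open>x\<close> is multiplication by its
    conjugate, which preserves \<open>H\<close>.\<close>
  have HP: "x \<star> y \<in> ?P" if "x \<in> H" "y \<in> ?P" for x y
    unfolding P
  proof
    fix z assume "z \<in> H"
    from mult[OF conj[OF that(1)] this] that(2) have "(((2 * x $ 0) *\<^sub>R e 0 - x) \<star> z) \<bullet> y = 0" by (simp only: P)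
    then show "z \<bullet> (x \<star> y) = 0" using oct_inner_mult_left[of x y z] by (simp only: inner_commute)
  qed
  have PH: "y \<star> x \<in> ?P" if "x \<in> H" "y \<in> ?P" for x y
    unfolding P
  proof
    fix z assume "z \<in> H"
    from mult[OF this conj[OF that(1)]] that(2) have "(z \<star> ((2 * x $ 0) *\<^sub>R e 0 - x)) \<bullet> y = 0" by (simp only: P)
    then show "z \<bullet> (y \<star> x) = 0" using oct_inner_mult_right[of y x z] by (simp only: inner_commute)
  qed
  have im: "y $ 0 = 0" if "y \<in> ?P" for y
    using that e0 by (auto simp: P inner_8 e_nth)
  \<comment> \<open>Cayley-Dickson doubling: for any nonzero \<open>u\<close> in \<open>?P\<close>,
    each element of \<open>?P\<close> is \<open>a \<star> u\<close> with \<open>a\<close> in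
    \<open>H\<close>, by injectivity and equality of dimensions.\<close>
  obtain u where u: "u \<in> ?P" "u \<noteq> 0"
    using dimP(1) by (metis dim_eq_0 subsetI singletonI zero_neq_numeral)
  have uu: "(a \<star> u) \<star> u = - (u \<bullet> u) *\<^sub>R a" for a
  proof -
    have "2 *\<^sub>R ((a \<star> u) \<star> u) = 2 *\<^sub>R (- (u \<bullet> u) *\<^sub>R a)"
      using oct_right_alternative[of a u u] unfolding oct_anticommute
      by (simp add: im[OF u(1)] oct_mult_linear scaleR_2)
    then show ?thesis by (rule scaleR_left_imp_eq[rotated]) simp
  qed
  have lin: "linear (\<lambda>a. a \<star> u)" by (rule linearI) (simp_all add: oct_mult_linear)
  have "inj_on (\<lambda>a. a \<star> u) (span H)"
  proof (rule inj_onI)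
    fix a b assume "a \<star> u = b \<star> u"
    then have "(a \<star> u) \<star> u = (b \<star> u) \<star> u" by simp
    then have "- (u \<bullet> u) *\<^sub>R a = - (u \<bullet> u) *\<^sub>R b" unfolding uu .
    then show "a = b" using u(2) by simp
  qed
  from dim_image_eq[OF lin this] have "dim ((\<lambda>a. a \<star> u) ` H) = 4" by (simp only: dimP)
  then have Pu: "(\<lambda>a. a \<star> u) ` H = ?P"
    using HP[OF _ u(1)] dimP(1) by (intro subspace_dim_equal[OF linear_subspace_image[OF lin sub] subP]) auto
  have PP: "x \<star> y \<in> H" if xy: "x \<in> ?P" "y \<in> ?P" for x y
  proof -
    obtain a where a: "a \<in> H" "x = a \<star> u" using xy(1) Pu by blast
    obtain b where b: "b \<in> H" "y = b \<star> u" using xy(2) Pu by blast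
    \<comment> \<open>The imaginary part of \<open>b\<close>. It is orthogonal to \<open>x\<close>
      and so anticommutes with it; left alternativity then moves it out of the product.\<close>
    define c where "c = b - b $ 0 *\<^sub>R e 0"
    have c: "c \<in> H" "c $ 0 = 0" "b = b $ 0 *\<^sub>R e 0 + c"
      using b(1) sub e0 by (simp_all add: c_def subspace_diff subspace_scale e_nth)
    have "x \<star> c + c \<star> x = 0"
    proof -
      have "x \<bullet> c = 0" using xy(1) c(1) unfolding P by (simp add: inner_commute[of x c])
      then show ?thesis using im[OF xy(1)] c(2) unfolding oct_anticommute by simp
    qed
    then have "x \<star> (c \<star> u) + c \<star> (x \<star> u) = 0"
      unfolding oct_left_alternative by (simp only: oct_mult_zero_left)
    then have xcu: "x \<star> (c \<star> u) = - (c \<star> (x \<star> u))" by (simp only: eq_neg_iff_add_eq_0)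
    have xu: "x \<star> u = - (u \<bullet> u) *\<^sub>R a" unfolding a(2) by (rule uu)
    have y: "y = b $ 0 *\<^sub>R u + c \<star> u" by (simp add: b(2) c_def oct_mult_linear)
    have "x \<star> y = b $ 0 *\<^sub>R (x \<star> u) + x \<star> (c \<star> u)"
      unfolding y by (simp only: oct_mult_add_right oct_mult_scaleR_right)
    also have "\<dots> = (u \<bullet> u) *\<^sub>R (c \<star> a) - (b $ 0 * (u \<bullet> u)) *\<^sub>R a"
      unfolding xcu xu by (simp add: oct_mult_linear)
    also have "\<dots> \<in> H"
      using mult[OF c(1) a(1)] a(1) sub by (intro subspace_diff subspace_scale)
    finally show ?thesis .
  qed
  have TH: "T *v x = x" if "x \<in> H" for x using refl that by (simp add: quaternionic_reflection_def)
  have TP: "T *v x = - x" if "x \<in> ?P" for x using refl that by (simp add: quaternionic_reflection_def)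
  have split: "\<exists>u\<in>H. \<exists>v\<in>?P. x = u + v" for x
    using subspace_sum_orthogonal_comp[OF sub] by (metis UNIV_I set_plus_elim)
  have "T *v (x \<star> y) = (T *v x) \<star> (T *v y)" for x y
  proof -
    obtain u v where x: "u \<in> H" "v \<in> ?P" "x = u + v" using split by blast
    obtain u' v' where y: "u' \<in> H" "v' \<in> ?P" "y = u' + v'" using split by blast
    have "x \<star> y = u \<star> u' + v \<star> v' + (u \<star> v' + v \<star> u')"
      by (simp add: x(3) y(3) oct_mult_linear)
    moreover have "u \<star> u' + v \<star> v' \<in> H" "u \<star> v' + v \<star> u' \<in> ?P"
      using x y mult PP HP PH sub subP by (simp_all add: subspace_add)
    ultimately have "T *v (x \<star> y) = u \<star> u' + v \<star> v' - (u \<star> v' + v \<star> u')"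
      using TH[of "u \<star> u' + v \<star> v'"] TP[of "u \<star> v' + v \<star> u'"]
      by (simp only: matrix_vector_right_distrib[of T "u \<star> u' + v \<star> v'"]) simp
    also have "\<dots> = (T *v x) \<star> (T *v y)"
      using x y by (simp add: matrix_vector_right_distrib TH TP oct_mult_linear)
    finally show ?thesis .
  qed
  moreover show TT: "T ** T = mat 1"
  proof -
    have "(T ** T) *v x = mat 1 *v x" for x
    proof -
      obtain u v where x: "u \<in> H" "v \<in> ?P" "x = u + v" using split by blast
      then show ?thesis
        by (simp add: matrix_vector_mul_assoc[symmetric] matrix_vector_right_distrib TH TP mv_minus)
    qed
    then show ?thesis by (simp add: matrix_eq)
  qed
  ultimately show "T \<in> G2"
    unfolding G2_def invertible_def using TT by blast
qed

theorem theorem9p2: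
  shows "(\<forall>T\<in>\<C>.
      ((*v) T ` H_A \<noteq> H_A \<longleftrightarrow> (\<exists>Z\<in>\<kk> H_A. Lie {Z, T ** Z ** T} = g2)) \<and>
      ((*v) T ` H_A \<noteq> H_A \<longleftrightarrow>
        (\<exists>i\<in>{1,2}. \<exists>j\<in>{1,2,3}. Lie {U i j, T ** U i j ** T} = g2)) \<and>
      ((*v) T ` H_A \<noteq> H_A \<longrightarrow>
        {Z \<in> \<kk> H_A. Lie {Z, T ** Z ** T} = g2} \<noteq> {} \<and>
        zariski_open_in (\<kk> H_A) {Z \<in> \<kk> H_A. Lie {Z, T ** Z ** T} = g2} \<and>
        null_in (\<kk> H_A) (\<kk> H_A - {Z \<in> \<kk> H_A. Lie {Z, T ** Z ** T} = g2}))) \<and>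
    (\<forall>g\<in>G2. \<forall>H. H = (*v) g ` H_A \<longrightarrow> (\<forall>T\<in>\<C>.
      ((*v) T ` H \<noteq> H \<longleftrightarrow> (\<exists>Z\<in>\<kk> H. Lie {Z, T ** Z ** T} = g2)) \<and>
      ((*v) T ` H \<noteq> H \<longleftrightarrow>
        (\<exists>i\<in>{1,2}. \<exists>j\<in>{1,2,3}.
          Lie {g ** U i j ** matrix_inv g, T ** (g ** U i j ** matrix_inv g) ** T} = g2)) \<and>
      ((*v) T ` H \<noteq> H \<longrightarrow>
        {Z \<in> \<kk> H. Lie {Z, T ** Z ** T} = g2} \<noteq> {} \<and>
        zariski_open_in (\<kk> H) {Z \<in> \<kk> H. Lie {Z, T ** Z ** T} = g2} \<and>
        null_in (\<kk> H) (\<kk> H - {Z \<in> \<kk> H. Lie {Z, T ** Z ** T} = g2}))))"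
proof -
  have inv: "T \<in> G2" "T ** T = mat 1" if "T \<in> \<C>" for T
    using that quaternionic_reflection_involution by (auto simp: \<C>_def)
  have one: "mat 1 \<in> G2" by (simp add: G2_def invertible_def)
  \<comment> \<open>The assertion for \<open>H_A\<close> is the case of the identity
    automorphism.\<close>
  have HA: "H_A = (*v) (mat 1) ` H_A" by simp
  \<comment> \<open>\<open>matrix_inv\<close> is defined by choice; invertibility of the elements of
    \<open>G2\<close> makes the chosen matrix an inverse.\<close>
  have right_inverse: "g ** matrix_inv g = mat 1" if "g \<in> G2" for g
    using that someI_ex[of "\<lambda>g'. g ** g' = mat 1 \<and> g' ** g = mat 1"]
    by (simp add: G2_def invertible_def matrix_inv_def)
  show ?thesis
    using context_equivalences[OF inv one matrix_mul_lid HA, unfolded matrix_mul_lid matrix_mul_rid]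
    by (intro conjI[OF ballI]) (assumption | intro ballI allI impI context_equivalences[OF inv _ right_inverse])+
qed

end
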